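(* Let $n,\ell,t$ be integers with $1\leq t\leq n-2$ and $n+t+2\leq \ell$, and assume $(\ell,q)\neq(n+t+2,2)$ and $(\ell,q)\neq(n+t+3,2)$. Let $\mathcal{F}\subseteq{V\brack n,0}$ be a non-trivial $t$-intersecting family. Then: (i) If $1\leq t\leq \frac{n}{2}-1$, then $|\mathcal{F}|\leq q^{\ell(n-t)}-\prod_{j=1}^{n-t}(q^\ell-q^j)+q^{n-t}(q^t-1)$, with equality if and only if $\mathcal{F}=\mathcal{H}_1(X,M)$ for some $(t,0)$-subspace $X$ and $(n+1,1)$-subspace $M$ of $V$ with $X\subseteq M$. (ii) If $\frac{n}{2}-\frac{1}{2}\leq t\leq n-2$, then $|\mathcal{F}|\leq q^{\ell(n-t-1)}\theta_{t+2}-q^{\ell(n-t-2)+1}\theta_{t+1}$, with equality if and only if $\mathcal{F}=\{F\in{V\brack n,0}:\dim(F\cap Z)\ge t+1\}$ for some $(t+2,0)$-subspace $Z$ of $V$.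
   Context: Let $q$ be a prime power, $V$ an $(n+\ell)$-dimensional vector space over $\mathbb{F}_q$ and $W$ a fixed $\ell$-dimensional subspace of $V$. A subspace $P$ of $V$ has type $(m,s)$ (is an $(m,s)$-subspace) if $\dim P=m$ and $\dim(P\cap W)=s$. For a subspace $S$ of $V$, ${S\brack m,s}$ denotes the set of all $(m,s)$-subspaces of $V$ contained in $S$. $\theta_a=(q^a-1)/(q-1)$. A family $\mathcal{F}\subseteq{V\brack n,0}$ is $t$-intersecting if $\dim(A\cap B)\ge t$ for all $A,B\in\mathcal F$; it is non-trivial if $\dim(\bigcap_{F\in\mathcal F}F)<t$. For a $(t,0)$-subspace $X$ and an $(n+1,1)$-subspace $M$ with $X\subseteq M$, $\mathcal{H}_1(X,M)=\{F\in{V\brack n,0}: X\subseteq F,\ \dim(F\cap M)\ge t+1\}\cup{M\brack n,0}$. *)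

theory Defs
  imports Complex_Main "HOL-Library.Cardinality"
begin

text \<open>
  The field with \<open>q\<close> elements is a finite field type \<open>'a\<close> with \<open>q = CARD('a)\<close>; the ambient
  space \<open>V\<close> is the whole type \<open>'b\<close> of vectors, i.e. \<open>UNIV\<close>. The scalar multiplication and the
  distinguished subspace are the explicit parameters \<open>scale\<close> and \<open>W\<close>.
\<close>

definition theta :: "nat \<Rightarrow> nat \<Rightarrow> real" where
  "theta q a = (real q ^ a - 1) / (real q - 1)"

definition has_type ::
  "('a::field \<Rightarrow> 'b::ab_group_add \<Rightarrow> 'b) \<Rightarrow> 'b set \<Rightarrow> nat \<Rightarrow> nat \<Rightarrow> 'b set \<Rightarrow> bool" where
  "has_type scale W m s P \<longleftrightarrow>
     module.subspace scale P \<and> vector_space.dim scale P = m \<and> vector_space.dim scale (P \<inter> W) = s"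

definition subspaces_of_type ::
  "('a::field \<Rightarrow> 'b::ab_group_add \<Rightarrow> 'b) \<Rightarrow> 'b set \<Rightarrow> 'b set \<Rightarrow> nat \<Rightarrow> nat \<Rightarrow> 'b set set" where
  "subspaces_of_type scale W S m s = {P. has_type scale W m s P \<and> P \<subseteq> S}"

definition t_intersecting ::
  "('a::field \<Rightarrow> 'b::ab_group_add \<Rightarrow> 'b) \<Rightarrow> nat \<Rightarrow> 'b set set \<Rightarrow> bool" where
  "t_intersecting scale t \<F> \<longleftrightarrow> (\<forall>A\<in>\<F>. \<forall>B\<in>\<F>. t \<le> vector_space.dim scale (A \<inter> B))"

text \<open>For \<open>\<F> = {}\<close> the intersection is \<open>UNIV\<close>, so the empty family counts as trivial as soon
  as \<open>t\<close> is at most the dimension of \<open>V\<close>.\<close>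

definition nontrivial ::
  "('a::field \<Rightarrow> 'b::ab_group_add \<Rightarrow> 'b) \<Rightarrow> nat \<Rightarrow> 'b set set \<Rightarrow> bool" where
  "nontrivial scale t \<F> \<longleftrightarrow> vector_space.dim scale (\<Inter>\<F>) < t"

definition H1 ::
  "('a::field \<Rightarrow> 'b::ab_group_add \<Rightarrow> 'b) \<Rightarrow> 'b set \<Rightarrow> nat \<Rightarrow> nat \<Rightarrow> 'b set \<Rightarrow> 'b set \<Rightarrow> 'b set set" where
  "H1 scale W n t X M =
     {F \<in> subspaces_of_type scale W UNIV n 0. X \<subseteq> F \<and> t + 1 \<le> vector_space.dim scale (F \<inter> M)}
     \<union> subspaces_of_type scale W M n 0"

end

theory Submission
  imports Defs
begin

text \<open>
  Call a subspace \<open>T\<close> with \<open>T \<inter> W = 0\<close> a cover of the family if every member meets it in dimension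
  at least \<open>t\<close>. If \<open>X\<close> is not a cover, some member \<open>F'\<close> meets it in dimension less than \<open>t\<close>, and then
  every member through \<open>X\<close> contains one of at most \<open>\<theta>\<^bsub>n-t+1\<^esub>\<close> subspaces of dimension \<open>dim X + 1\<close>.
  Starting from the \<open>t\<close>-subspaces of a cover of minimal dimension \<open>\<tau>\<close> and iterating, one bounds the
  family; for \<open>\<tau> \<ge> t + 2\<close> the bound is below both extremal sizes.

  If \<open>\<tau> = t + 1\<close>, enlarge the family to a maximal one. Then the \<open>(t+1)\<close>-dimensional covers meet
  pairwise in dimension at least \<open>t\<close>, so they either lie in a common \<open>(t+2)\<close>-space \<open>Z\<close>, and all members
  meet \<open>Z\<close> in dimension at least \<open>t + 1\<close>, or they share a \<open>t\<close>-space \<open>X\<close>. In the latter case all these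
  covers lie in \<open>X + F\<close> for every member \<open>F\<close> not containing \<open>X\<close>. If \<open>X + F\<close> is always the same space \<open>M\<close>,
  the family is contained in \<open>H1 X M\<close>; otherwise there are at most \<open>\<theta>\<^bsub>n-t\<^esub>\<close> such covers, which is too
  few for an extremal family.
\<close>

section \<open>Counting subspaces over a finite field\<close>

locale finite_field_vector_space = finite_dimensional_vector_space scale Basis
  for scale :: "'a::{field,finite} \<Rightarrow> 'b::ab_group_add \<Rightarrow> 'b" (infixr "*s" 75) and Basis +
  fixes q :: nat
  assumes card_field: "CARD('a) = q"
begin

abbreviation \<theta> :: "nat \<Rightarrow> real" where "\<theta> \<equiv> theta q"

lemma q_ge_2: "2 \<le> q"
proof -
  have "card {0, 1 :: 'a} \<le> CARD('a)"
    by (rule card_mono) auto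
  then show ?thesis
    by (simp add: card_field)
qed

section \<open>Dimensions of sums, intersections and extensions of subspaces\<close>

lemma span_of_subspace [simp]: "subspace S \<Longrightarrow> span S = S"
  by simp

lemma dim_Un_Int:
  assumes "subspace S" "subspace T"
  shows "dim (S \<union> T) + dim (S \<inter> T) = dim S + dim T"
proof -
  have "span (S \<union> T) = {x + y |x y. x \<in> S \<and> y \<in> T}"
    using assms by (simp add: span_Un)
  then show ?thesis
    using dim_sums_Int[OF assms] by (metis dim_span)
qed

lemma dim_Int_ge:
  assumes "subspace A" "subspace B" "subspace C" "A \<subseteq> C" "B \<subseteq> C"
  shows "dim A + dim B \<le> dim (A \<inter> B) + dim C"
proof -
  have "dim (A \<union> B) \<le> dim C"
    using assms by (intro dim_subset) auto
  then show ?thesis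
    using dim_Un_Int[of A B] assms by simp
qed

lemma dim_trivial_subspace: "subspace S \<Longrightarrow> dim S = 0 \<longleftrightarrow> S = {0}"
  using subspace_0[of S] by auto

lemma dim_span_insert: "subspace S \<Longrightarrow> v \<notin> S \<Longrightarrow> dim (span (insert v S)) = dim S + 1"
  by (simp add: dim_insert)

lemma one_step_extension:
  assumes "subspace X" "subspace Y" "X \<subseteq> Y" "v \<in> Y" "v \<notin> X" "dim Y = dim X + 1"
  shows "Y = span (insert v X)"
proof -
  have "span (insert v X) \<subseteq> Y"
    using assms by (intro span_minimal) auto
  then show ?thesis
    using subspace_dim_equal[of "span (insert v X)" Y] assms dim_span_insert[of X v]
    by auto
qed

text \<open>A vector of \<open>S\<close> with a nonzero \<open>v\<close>-coordinate over
  \<open>P\<close> could be solved for \<open>v\<close>, which would put \<open>v\<close> into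
  \<open>span (P \<union> S)\<close>. This is how a subspace is enlarged below without changing its
  trace on \<open>W\<close>, \<open>M\<close> or a cover.\<close>

lemma span_insert_subspace_Int:
  assumes "subspace P" "subspace S" "v \<notin> span (P \<union> S)"
  shows "span (insert v P) \<inter> S = P \<inter> S"
proof
  show "P \<inter> S \<subseteq> span (insert v P) \<inter> S"
    using span_superset[of "insert v P"] by auto
  show "span (insert v P) \<inter> S \<subseteq> P \<inter> S"
  proof
    fix x assume x: "x \<in> span (insert v P) \<inter> S"
    then obtain k where k: "x - k *s v \<in> P"
      using assms(1) span_breakdown_eq[of x v P] by auto
    show "x \<in> P \<inter> S"
    proof (cases "k = 0")
      case True
      then show ?thesis using k x by simp
    next
      case False
      have "x \<in> span (P \<union> S)" "x - k *s v \<in> span (P \<union> S)"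
        using x k by (auto intro: span_base)
      then have "x - (x - k *s v) \<in> span (P \<union> S)"
        by (rule span_diff)
      then have "k *s v \<in> span (P \<union> S)"
        by simp
      then have "inverse k *s (k *s v) \<in> span (P \<union> S)"
        by (rule span_scale)
      then show ?thesis
        using False assms(3) by simp
    qed
  qed
qed

lemma subspace_extend_within:
  assumes "subspace X" "subspace Y" "X \<subseteq> Y" "dim X \<le> m" "m \<le> dim Y"
  obtains U where "subspace U" "X \<subseteq> U" "U \<subseteq> Y" "dim U = m"
proof -
  have "\<exists>U. subspace U \<and> X \<subseteq> U \<and> U \<subseteq> Y \<and> dim U = m"
    using assms(4,5)
  proof (induction m rule: dec_induct)
    case base
    then show ?case using assms by auto
  next
    case (step m)
    then obtain U where U: "subspace U" "X \<subseteq> U" "U \<subseteq> Y" "dim U = m"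
      by auto
    then obtain y where y: "y \<in> Y" "y \<notin> U"
      using step.prems by (metis not_less_eq_eq order_refl subsetI subset_antisym)
    have "span (insert y U) \<subseteq> Y"
      using U y assms by (intro span_minimal) auto
    moreover have "dim (span (insert y U)) = Suc m"
      using dim_span_insert[of U y] U y by simp
    moreover have "X \<subseteq> span (insert y U)"
      using U span_superset[of "insert y U"] by auto
    ultimately show ?case
      by (intro exI[of _ "span (insert y U)"]) simp
  qed
  then show ?thesis using that by blast
qed

section \<open>Counting vectors, extensions, complements and hyperplanes\<close>

lemma subspace_finite_card:
  assumes "subspace S"
  shows "finite S \<and> card S = q ^ dim S"
  using assms
proof (induction "dim S" arbitrary: S)
  case 0
  then have "S = {0}" using dim_trivial_subspace by simp
  then show ?case by simp
next
  case (Suc d)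
  obtain T where T: "subspace T" "T \<subseteq> S" "dim T = d"
    using subspace_extend_within[of "{0}" S d] Suc.hyps(2) Suc.prems subspace_0 by auto
  then obtain y where y: "y \<in> S" "y \<notin> T"
    using Suc.hyps(2) by (metis n_not_Suc_n subsetI subset_antisym)
  have S: "S = span (insert y T)"
    using one_step_extension[of T S y] T y Suc by auto
  have IH: "finite T" "card T = q ^ d"
    using Suc.hyps(1)[of T] T by auto
  \<comment> \<open>Coordinates over the hyperplane \<open>T\<close> identify \<open>S\<close> with
    \<open>T \<times> UNIV\<close>, so every dimension contributes one factor
    \<open>q\<close>.\<close>
  let ?f = "\<lambda>(x, k). x + k *s y"
  have "inj_on ?f (T \<times> UNIV)"
  proof (rule inj_onI, clarify)
    fix x k x' k' assume xx: "x \<in> T" "x' \<in> T" and eq: "x + k *s y = x' + k' *s y"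
    have "(k - k') *s y = x' - x"
      using eq by (simp add: scale_left_diff_distrib algebra_simps)
    then have m: "(k - k') *s y \<in> T"
      using xx T subspace_diff by metis
    have "k = k'"
    proof (rule ccontr)
      assume "k \<noteq> k'"
      then have "inverse (k - k') *s ((k - k') *s y) = y" by simp
      then show False using m T subspace_scale y by metis
    qed
    then show "x = x' \<and> k = k'" using eq by simp
  qed
  moreover have "?f ` (T \<times> UNIV) = S"
  proof
    show "?f ` (T \<times> UNIV) \<subseteq> S"
      using T y Suc.prems by (auto intro!: subspace_add subspace_scale)
    show "S \<subseteq> ?f ` (T \<times> UNIV)"
    proof
      fix x assume "x \<in> S"
      then obtain k where "x - k *s y \<in> T"
        using S span_breakdown_eq[of x y T] T by auto
      then show "x \<in> ?f ` (T \<times> UNIV)"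
        by (intro image_eqI[of _ _ "(x - k *s y, k)"]) auto
    qed
  qed
  ultimately have "bij_betw ?f (T \<times> UNIV) S"
    by (simp add: bij_betw_def)
  moreover have "finite (T \<times> (UNIV :: 'a set))"
    using IH by simp
  moreover have "card (T \<times> (UNIV :: 'a set)) = q ^ dim S"
    using IH Suc.hyps(2) by (simp add: card_cartesian_product card_field flip: Suc.hyps(2))
  ultimately show ?case
    using bij_betw_finite bij_betw_same_card by metis
qed

lemma card_subspace: "subspace S \<Longrightarrow> card S = q ^ dim S"
  using subspace_finite_card by blast

lemma finite_vectors [simp]: "finite (A :: 'b set)"
  using subspace_finite_card[OF subspace_UNIV] finite_subset[OF subset_UNIV] by blast

lemma finite_vector_sets [simp]: "finite (\<A> :: 'b set set)"
  by (meson finite_Pow_iff finite_subset finite_vectors subset_Pow_Union)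

lemma theta_mult: "\<theta> m * (real q - 1) = real q ^ m - 1"
  using q_ge_2 by (simp add: theta_def)

text \<open>An extension is determined by any one of its vectors outside \<open>X\<close>, so the
  sets \<open>Y - X\<close> partition \<open>U - X\<close>; all of them have the same size.\<close>

lemma card_one_step_extensions:
  assumes "subspace X" "subspace U" "X \<subseteq> U"
  shows "real (card {Y. subspace Y \<and> X \<subseteq> Y \<and> Y \<subseteq> U \<and> dim Y = dim X + 1}) = \<theta> (dim U - dim X)"
proof -
  let ?Y = "{Y. subspace Y \<and> X \<subseteq> Y \<and> Y \<subseteq> U \<and> dim Y = dim X + 1}"
  have le: "dim X \<le> dim U"
    using assms dim_subset by auto
  have "U - X = (\<Union>Y\<in>?Y. Y - X)"
  proof
    show "U - X \<subseteq> (\<Union>Y\<in>?Y. Y - X)"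
    proof
      fix v assume v: "v \<in> U - X"
      have "span (insert v X) \<in> ?Y"
        using v assms dim_span_insert[of X v] span_minimal[of "insert v X" U]
          span_superset[of "insert v X"] by auto
      moreover have "v \<in> span (insert v X)"
        by (simp add: span_base)
      ultimately show "v \<in> (\<Union>Y\<in>?Y. Y - X)"
        using v by blast
    qed
  qed auto
  then have "card (U - X) = (\<Sum>Y\<in>?Y. card (Y - X))"
  proof (simp only:, intro card_UN_disjoint ballI impI)
    fix Y Y' assume Y: "Y \<in> ?Y" "Y' \<in> ?Y" "Y \<noteq> Y'"
    show "(Y - X) \<inter> (Y' - X) = {}"
    proof (rule ccontr)
      assume "(Y - X) \<inter> (Y' - X) \<noteq> {}"
      then obtain v where "v \<in> Y" "v \<in> Y'" "v \<notin> X" by auto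
      then show False
        using Y one_step_extension[of X Y v] one_step_extension[of X Y' v] assms by auto
    qed
  qed auto
  also have "\<dots> = (\<Sum>Y\<in>?Y. q ^ (dim X + 1) - q ^ dim X)"
    using assms by (intro sum.cong) (auto simp: card_Diff_subset card_subspace)
  finally have "q ^ dim U - q ^ dim X = card ?Y * (q ^ (dim X + 1) - q ^ dim X)"
    using assms by (simp add: card_Diff_subset card_subspace)
  moreover have "q ^ dim X \<le> q ^ dim U" "q ^ dim X \<le> q ^ (dim X + 1)"
    using le q_ge_2 by (auto intro!: power_increasing)
  ultimately have "real q ^ dim U - real q ^ dim X
      = real (card ?Y) * (real q ^ (dim X + 1) - real q ^ dim X)"
    by (metis (no_types, lifting) of_nat_diff of_nat_mult of_nat_power)
  moreover have "real q ^ dim U = real q ^ (dim U - dim X) * real q ^ dim X"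
    using le by (simp flip: power_add)
  ultimately have "real q ^ dim X * (\<theta> (dim U - dim X) * (real q - 1))
      = real q ^ dim X * (real (card ?Y) * (real q - 1))"
    unfolding theta_mult by (simp add: algebra_simps)
  then show ?thesis
    using q_ge_2 by (simp del: of_nat_power)
qed

text \<open>Induction on the dimension still missing. Each of the \<open>q ^ dim W\<close> choices
  for the vector in a coset of \<open>W\<close> leaves the same problem with \<open>P\<close> one
  dimension larger. The exponent is that of the number of linear maps from the quotient of
  \<open>U\<close> by \<open>P + W\<close> into \<open>W\<close>.\<close>

lemma card_complements:
  assumes "subspace U" "subspace W" "W \<subseteq> U" "subspace P" "P \<subseteq> U" "P \<inter> W = {0}"
  shows "card {F. subspace F \<and> P \<subseteq> F \<and> F \<subseteq> U \<and> F \<inter> W = {0} \<and> dim F + dim W = dim U}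
    = q ^ (dim W * (dim U - dim W - dim P))"
  using assms(4-6)
proof (induction "dim U - dim W - dim P" arbitrary: P)
  case 0
  have "dim P + dim W \<le> dim U"
    using dim_Int_ge[of P W U] 0 assms by simp
  with 0 have eq: "dim P + dim W = dim U" by linarith
  have "{F. subspace F \<and> P \<subseteq> F \<and> F \<subseteq> U \<and> F \<inter> W = {0} \<and> dim F + dim W = dim U} = {P}"
  proof -
    have "F = P" if "subspace F" "P \<subseteq> F" "dim F + dim W = dim U" for F
      using subspace_dim_equal[of P F] that 0 eq by simp
    then show ?thesis using 0 eq by auto
  qed
  then show ?case using 0 by simp
next
  case (Suc d)
  let ?C = "\<lambda>P. {F. subspace F \<and> P \<subseteq> F \<and> F \<subseteq> U \<and> F \<inter> W = {0} \<and> dim F + dim W = dim U}"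
  have "dim (span (P \<union> W)) < dim U"
    using dim_Un_Int[of P W] Suc assms by simp
  then have "\<not> U \<subseteq> span (P \<union> W)"
    using dim_subset[of U "span (P \<union> W)"] by linarith
  then obtain v where v: "v \<in> U" "v \<notin> span (P \<union> W)"
    by blast
  \<comment> \<open>A complement \<open>F\<close> of \<open>W\<close> contains exactly one vector of the coset \<open>v + W\<close>.\<close>
  let ?P = "\<lambda>w. span (insert (v + w) P)"
  have vw: "v + w \<notin> span (P \<union> W)" if "w \<in> W" for w
    using that v span_add_eq2[of w "P \<union> W" v] span_base by blast
  have "?C P = (\<Union>w\<in>W. ?C (?P w))"
  proof
    show "?C P \<subseteq> (\<Union>w\<in>W. ?C (?P w))"
    proof
      fix F assume F: "F \<in> ?C P"
      have "dim (F \<union> W) = dim U"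
        using dim_Un_Int[of F W] F assms by simp
      then have "span (F \<union> W) = U"
        using subspace_dim_equal[of "span (F \<union> W)" U] F assms by (simp add: span_minimal)
      then have "v \<in> {x + y |x y. x \<in> span F \<and> y \<in> span W}"
        using v by (simp flip: span_Un)
      then obtain x y where xy: "v = x + y" "x \<in> F" "y \<in> W"
        using F assms(2) by auto
      then have "?P (-y) \<subseteq> F"
        using F by (intro span_minimal) auto
      then have "F \<in> ?C (?P (-y))"
        using F by auto
      moreover have "-y \<in> W"
        using xy assms(2) subspace_neg by simp
      ultimately show "F \<in> (\<Union>w\<in>W. ?C (?P w))"
        by (intro UN_I)
    qed
    have "P \<subseteq> ?P w" for w
      using span_superset[of "insert (v + w) P"] by simp
    then have "?C (?P w) \<subseteq> ?C P" for w
      by (smt (verit, best) Collect_mono_iff order_trans)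
    then show "(\<Union>w\<in>W. ?C (?P w)) \<subseteq> ?C P"
      by (intro UN_least)
  qed
  moreover have "card (\<Union>w\<in>W. ?C (?P w)) = (\<Sum>w\<in>W. card (?C (?P w)))"
  proof (intro card_UN_disjoint ballI impI)
    fix w w' assume w: "w \<in> W" "w' \<in> W" "w \<noteq> w'"
    show "?C (?P w) \<inter> ?C (?P w') = {}"
    proof (rule ccontr)
      assume "?C (?P w) \<inter> ?C (?P w') \<noteq> {}"
      then obtain F where F: "F \<in> ?C (?P w)" "F \<in> ?C (?P w')" by blast
      have "v + w \<in> ?P w" "v + w' \<in> ?P w'"
        by (simp_all add: span_base)
      then have "v + w \<in> F" "v + w' \<in> F"
        using F by blast+
      then have "(v + w) - (v + w') \<in> F"
        using F subspace_diff by blast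
      then have "w - w' \<in> F \<inter> W"
        using w assms subspace_diff by auto
      then have "w - w' = 0" using F by blast
      then show False using w by simp
    qed
  qed auto
  moreover have "card (?C (?P w)) = q ^ (dim W * d)" if "w \<in> W" for w
  proof -
    have "v + w \<notin> P" using vw[OF that] by (meson UnI1 span_base)
    then have "dim (?P w) = dim P + 1"
      using Suc dim_span_insert[of P "v + w"] by auto
    moreover have "?P w \<subseteq> U"
      using v that assms Suc by (intro span_minimal) (auto intro: subspace_add)
    moreover have "?P w \<inter> W = {0}"
      using span_insert_subspace_Int[OF _ _ vw[OF that]] Suc assms by simp
    moreover have "d = dim U - dim W - dim (?P w)"
      using Suc.hyps(2) \<open>dim (?P w) = dim P + 1\<close> by linarith
    ultimately show ?thesis
      using Suc.hyps(1)[of "?P w"] subspace_span by metis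
  qed
  ultimately have "card (?C P) = q ^ dim W * q ^ (dim W * d)"
    using assms by (simp add: card_subspace)
  moreover have "dim U - dim W - dim P = Suc d"
    using Suc.hyps(2) by simp
  ultimately show ?case
    by (simp only: mult_Suc_right power_add)
qed

text \<open>The induction of \<open>card_complements\<close> with fewer admissible vectors at each
  step. When \<open>P\<close> has dimension \<open>k\<close>, the forbidden translations form
  \<open>W \<inter> span (P \<union> M)\<close>, a space of dimension
  \<open>k - dim X + dim (M \<inter> W)\<close>; this is the subtracted power in the factor for
  \<open>k\<close>.\<close>

lemma card_complements_avoiding:
  assumes "subspace W" "subspace M" "subspace X" "X \<subseteq> M" "span (M \<union> W) = UNIV"
    and "subspace P" "P \<inter> W = {0}" "P \<inter> M = X" "dim P \<le> n" "n + dim W = dim UNIV"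
  shows "real (card {F. subspace F \<and> P \<subseteq> F \<and> F \<inter> W = {0} \<and> dim F = n \<and> F \<inter> M = X})
    = (\<Prod>k\<in>{dim P..<n}. real q ^ dim W - real q ^ (k - dim X + dim (M \<inter> W)))"
  using assms(6-9)
proof (induction "n - dim P" arbitrary: P)
  case 0
  have "F = P" if "subspace F" "P \<subseteq> F" "dim F = n" for F
    using subspace_dim_equal[of P F] that 0 by simp
  then have "{F. subspace F \<and> P \<subseteq> F \<and> F \<inter> W = {0} \<and> dim F = n \<and> F \<inter> M = X} = {P}"
    using 0 by auto
  then show ?case using 0 by simp
next
  case (Suc d)
  let ?C = "\<lambda>P. {F. subspace F \<and> P \<subseteq> F \<and> F \<inter> W = {0} \<and> dim F = n \<and> F \<inter> M = X}"
  have "dim (P \<union> W) < dim UNIV"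
    using dim_Un_Int[of P W] Suc assms(1,10) by simp
  \<comment> \<open>Because \<open>M\<close> and \<open>W\<close> together span everything, a vector
    outside \<open>P + W\<close> can be found inside \<open>M\<close>.\<close>
  then have "\<not> M \<union> W \<subseteq> span (P \<union> W)"
    using assms(5) by (metis dim_span dual_order.strict_iff_order span_minimal subspace_span
        top.extremum_uniqueI)
  then obtain v where v: "v \<in> M" "v \<notin> span (P \<union> W)"
    by (auto intro: span_base)
  let ?P = "\<lambda>w. span (insert (v + w) P)"
  \<comment> \<open>As \<open>v \<in> M\<close>, adjoining \<open>v + w\<close> keeps the intersection with \<open>M\<close> equal to \<open>X\<close> iff \<open>w \<notin> P + M\<close>.\<close>
  let ?B = "W \<inter> span (P \<union> M)"
  have vw: "v + w \<notin> span (P \<union> W)" if "w \<in> W" for w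
    using that v span_add_eq2[of w "P \<union> W" v] span_base by blast
  have vM: "v \<in> span (P \<union> M)"
    using v by (simp add: span_base)
  have "?C P = (\<Union>w\<in>W - ?B. ?C (?P w))"
  proof
    show "?C P \<subseteq> (\<Union>w\<in>W - ?B. ?C (?P w))"
    proof
      fix F assume F: "F \<in> ?C P"
      have "dim (F \<union> W) = dim UNIV"
        using dim_Un_Int[of F W] F assms by simp
      then have "span (F \<union> W) = UNIV"
        using subspace_dim_equal[of "span (F \<union> W)" UNIV] by (simp only: dim_span) simp
      then have "v \<in> {x + y |x y. x \<in> span F \<and> y \<in> span W}"
        by (simp flip: span_Un)
      then obtain x y where xy: "v = x + y" "x \<in> F" "y \<in> W"
        using F assms(1) by auto
      then have P: "?P (-y) \<subseteq> F"
        using F by (intro span_minimal) auto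
      \<comment> \<open>Otherwise \<open>x = p + m\<close> with
        \<open>m \<in> F \<inter> M = X \<subseteq> P\<close>, so \<open>x\<close> would lie in
        \<open>P\<close> and \<open>v = x + y\<close> in \<open>P + W\<close>.\<close>
      have "-y \<notin> span (P \<union> M)"
      proof
        assume "-y \<in> span (P \<union> M)"
        then have "x \<in> span (P \<union> M)"
          using vM xy span_add[of v _ "-y"] by fastforce
        then obtain p m where pm: "x = p + m" "p \<in> P" "m \<in> M"
          using Suc.prems(1) assms(2) by (auto simp: span_Un)
        then have "m \<in> F"
          using F xy subspace_diff[of F x p] by auto
        then have "m \<in> P" using F pm Suc.prems(3) by auto
        then have "x \<in> P" using pm Suc.prems(1) subspace_add by auto
        then show False
          using v xy span_add[of x "P \<union> W" y] by (simp add: span_base)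
      qed
      moreover have "-y \<in> W"
        using xy assms(1) subspace_neg by simp
      ultimately have "-y \<in> W - ?B"
        by simp
      moreover have "F \<in> ?C (?P (-y))"
        using F P by auto
      ultimately show "F \<in> (\<Union>w\<in>W - ?B. ?C (?P w))"
        by (intro UN_I)
    qed
    have "P \<subseteq> ?P w" for w
      using span_superset[of "insert (v + w) P"] by simp
    then have "?C (?P w) \<subseteq> ?C P" for w
      by (smt (verit, best) Collect_mono_iff order_trans)
    then show "(\<Union>w\<in>W - ?B. ?C (?P w)) \<subseteq> ?C P"
      by (intro UN_least)
  qed
  moreover have "card (\<Union>w\<in>W - ?B. ?C (?P w)) = (\<Sum>w\<in>W - ?B. card (?C (?P w)))"
  proof (intro card_UN_disjoint ballI impI)
    fix w w' assume w: "w \<in> W - ?B" "w' \<in> W - ?B" "w \<noteq> w'"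
    show "?C (?P w) \<inter> ?C (?P w') = {}"
    proof (rule ccontr)
      assume "?C (?P w) \<inter> ?C (?P w') \<noteq> {}"
      then obtain F where F: "F \<in> ?C (?P w)" "F \<in> ?C (?P w')" by blast
      have "v + w \<in> ?P w" "v + w' \<in> ?P w'"
        by (simp_all add: span_base)
      then have "v + w \<in> F" "v + w' \<in> F"
        using F by blast+
      then have "(v + w) - (v + w') \<in> F"
        using F subspace_diff by blast
      then have "w - w' \<in> F \<inter> W"
        using w assms subspace_diff by auto
      then have "w - w' = 0" using F by blast
      then show False using w by simp
    qed
  qed auto
  moreover have "real (card (?C (?P w)))
      = (\<Prod>k\<in>{Suc (dim P)..<n}. real q ^ dim W - real q ^ (k - dim X + dim (M \<inter> W)))"
    if w: "w \<in> W - ?B" for w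
  proof -
    have "v + w \<notin> P" using vw w by (meson DiffD1 UnI1 span_base)
    then have d: "dim (?P w) = dim P + 1"
      using Suc dim_span_insert[of P "v + w"] by auto
    have "v + w \<notin> span (P \<union> M)"
      using w vM span_add_eq[of v "P \<union> M" w] by auto
    then have "?P w \<inter> M = X"
      using span_insert_subspace_Int[of P M "v + w"] Suc.prems assms by simp
    moreover have "?P w \<inter> W = {0}"
      using span_insert_subspace_Int[of P W "v + w"] vw w Suc assms by simp
    ultimately show ?thesis
      using Suc.hyps(1)[of "?P w"] Suc.hyps(2) d by simp
  qed
  ultimately have c: "real (card (?C P)) = real (card (W - ?B))
      * (\<Prod>k\<in>{Suc (dim P)..<n}. real q ^ dim W - real q ^ (k - dim X + dim (M \<inter> W)))"
    by simp
  have X: "dim X \<le> dim P"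
    using Suc.prems dim_subset[of X P] by auto
  \<comment> \<open>Three applications of the dimension formula, to \<open>P + M\<close> with
    \<open>W\<close>, to \<open>M\<close> with \<open>W\<close> and to \<open>P\<close> with
    \<open>M\<close>, give the dimension of the forbidden set.\<close>
  have "span (span (P \<union> M) \<union> W) = UNIV"
    using assms(5) span_mono[of "M \<union> W" "span (P \<union> M) \<union> W"] span_superset[of "P \<union> M"] by blast
  then have "dim UNIV + dim ?B = dim (span (P \<union> M)) + dim W"
    using dim_Un_Int[of "span (P \<union> M)" W] assms(1)
    by (metis dim_span inf_commute subspace_span)
  moreover have "dim UNIV + dim (M \<inter> W) = dim M + dim W"
    using dim_Un_Int[of M W] assms(1,2,5) by (metis dim_span)
  moreover have "dim (P \<union> M) + dim X = dim P + dim M"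
    using dim_Un_Int[of P M] assms Suc.prems by simp
  ultimately have dB: "dim ?B = dim P - dim X + dim (M \<inter> W)"
    using X by simp
  have sB: "subspace ?B"
    using assms by (intro subspace_inter) auto
  have "card ?B \<le> card W"
    by (intro card_mono) auto
  then have "real (card (W - ?B)) = real q ^ dim W - real q ^ (dim P - dim X + dim (M \<inter> W))"
    using card_Diff_subset[of ?B W] card_subspace[OF sB] card_subspace[OF assms(1)] dB
    by (simp add: of_nat_diff)
  moreover have "{dim P..<n} = insert (dim P) {Suc (dim P)..<n}"
    using Suc.hyps(2) by auto
  ultimately show ?case
    using c by simp
qed

text \<open>Double counting of pairs of a nonzero vector \<open>v\<close> and a hyperplane
  \<open>H\<close> with \<open>v \<notin> H\<close>. For fixed \<open>v\<close> these hyperplanes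
  are the complements of the line through \<open>v\<close>; for fixed \<open>H\<close> the vectors
  are those of \<open>Z - H\<close>.\<close>

lemma card_hyperplanes:
  assumes "subspace Z" "1 \<le> dim Z"
  shows "real (card {H. subspace H \<and> H \<subseteq> Z \<and> dim H + 1 = dim Z}) = \<theta> (dim Z)"
proof -
  let ?H = "{H. subspace H \<and> H \<subseteq> Z \<and> dim H + 1 = dim Z}"
  have inner: "card (?H \<inter> {H. v \<notin> H}) = q ^ (dim Z - 1)" if v: "v \<in> Z - {0}" for v
  proof -
    have d: "dim (span {v}) = 1"
      using v by simp
    have "span {v} \<subseteq> Z"
      using v assms by (intro span_minimal) auto
    moreover have "(?H \<inter> {H. v \<notin> H}) = {F. subspace F \<and> {0} \<subseteq> F \<and> F \<subseteq> Z \<and> F \<inter> span {v} = {0}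
        \<and> dim F + dim (span {v}) = dim Z}"
    proof -
      have "v \<notin> H \<longleftrightarrow> H \<inter> span {v} = {0}" if H: "subspace H" for H
      proof
        assume "v \<notin> H"
        have "k *s v \<in> H \<Longrightarrow> k *s v = 0" for k
        proof (rule ccontr)
          assume k: "k *s v \<in> H" "k *s v \<noteq> 0"
          then have "inverse k *s k *s v \<in> H" using H subspace_scale by blast
          then show False using k \<open>v \<notin> H\<close> by simp
        qed
        then show "H \<inter> span {v} = {0}"
          using subspace_0[OF H] by (auto simp: span_singleton intro: range_eqI[of _ _ 0])
      next
        assume "H \<inter> span {v} = {0}"
        then show "v \<notin> H" using v span_base[of v "{v}"] by auto
      qed
      then show ?thesis using d by (auto simp: subspace_0)
    qed
    ultimately show ?thesis
      using card_complements[of Z "span {v}" "{0}"] assms d by (simp add: subspace_0)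
  qed
  have "(\<Sum>v\<in>Z - {0}. \<Sum>H\<in>?H. if v \<notin> H then 1 else 0)
      = (\<Sum>H\<in>?H. \<Sum>v\<in>Z - {0}. (if v \<notin> H then 1 else 0) :: nat)"
    by (rule sum.swap)
  moreover have "(\<Sum>v\<in>Z - {0}. \<Sum>H\<in>?H. (if v \<notin> H then 1 else 0) :: nat)
      = (\<Sum>v\<in>Z - {0}. q ^ (dim Z - 1))"
    using inner by (intro sum.cong) (simp_all add: sum.If_cases)
  moreover have "(\<Sum>H\<in>?H. \<Sum>v\<in>Z - {0}. (if v \<notin> H then 1 else 0) :: nat)
      = (\<Sum>H\<in>?H. q ^ dim Z - q ^ (dim Z - 1))"
  proof (rule sum.cong[OF refl])
    fix H assume H: "H \<in> ?H"
    have "(\<Sum>v\<in>Z - {0}. (if v \<notin> H then 1 else 0) :: nat) = card ((Z - {0}) \<inter> {v. v \<notin> H})"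
      by (simp add: sum.If_cases)
    also have "(Z - {0}) \<inter> {v. v \<notin> H} = Z - H"
      using H subspace_0 by auto
    also have "card (Z - H) = q ^ dim Z - q ^ dim H"
      using H assms by (simp add: card_Diff_subset card_subspace)
    also have "dim H = dim Z - 1" using H by auto
    finally show "(\<Sum>v\<in>Z - {0}. (if v \<notin> H then 1 else 0) :: nat) = q ^ dim Z - q ^ (dim Z - 1)" .
  qed
  ultimately have e: "(q ^ dim Z - 1) * q ^ (dim Z - 1) = card ?H * (q ^ dim Z - q ^ (dim Z - 1))"
    using assms card_Diff_subset[of "{0}" Z] by (simp add: card_subspace subspace_0)
  define h where "h = card ?H"
  obtain m where m: "dim Z = Suc m"
    using assms(2) by (cases "dim Z") auto
  have "1 \<le> q ^ Suc m" "q ^ m \<le> q ^ Suc m"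
    using q_ge_2 by simp_all
  then have "real ((q ^ Suc m - 1) * q ^ m) = (real q ^ Suc m - 1) * real q ^ m"
      "real (h * (q ^ Suc m - q ^ m)) = real h * (real q ^ Suc m - real q ^ m)"
    by (simp_all only: of_nat_mult of_nat_diff of_nat_power of_nat_1)
  then have "(real q ^ Suc m - 1) * real q ^ m = real h * (real q ^ Suc m - real q ^ m)"
    using e by (simp only: h_def m diff_Suc_1)
  then have "real q ^ m * (real q ^ Suc m - 1) = real q ^ m * (real h * (real q - 1))"
    by (simp add: algebra_simps)
  then have "\<theta> (Suc m) * (real q - 1) = real h * (real q - 1)"
    using q_ge_2 unfolding theta_mult by simp
  then show ?thesis
    using q_ge_2 by (simp add: m h_def)
qed

section \<open>The numbers \<open>\<theta> m\<close> and Gaussian binomial coefficients\<close>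

lemma theta_pos: "0 < m \<Longrightarrow> 0 < \<theta> m"
  using q_ge_2 by (simp add: theta_def)

lemma theta_0 [simp]: "\<theta> 0 = 0"
  by (simp add: theta_def)

lemma theta_Suc: "\<theta> (Suc m) = 1 + real q * \<theta> m"
  using q_ge_2 by (simp add: theta_def field_simps)

lemma theta_Suc': "\<theta> (Suc m) = \<theta> m + real q ^ m"
  using q_ge_2 by (simp add: theta_def field_simps)

lemma theta_nonneg: "0 \<le> \<theta> m"
  using theta_pos[of m] by (cases m) auto

lemma theta_mono: "m \<le> k \<Longrightarrow> \<theta> m \<le> \<theta> k"
  using q_ge_2 by (auto simp: theta_def intro!: divide_right_mono power_increasing)

text \<open>Double counting of inclusions between dimension \<open>k\<close> and dimension
  \<open>k + 1\<close>: one-step extensions on one side, hyperplanes on the other.\<close>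

lemma card_subspaces_step:
  assumes "subspace T" "k < dim T"
  shows "real (card {S. subspace S \<and> S \<subseteq> T \<and> dim S = k}) * \<theta> (dim T - k)
    = real (card {S. subspace S \<and> S \<subseteq> T \<and> dim S = k + 1}) * \<theta> (k + 1)"
proof -
  let ?G = "\<lambda>k. {S. subspace S \<and> S \<subseteq> T \<and> dim S = k}"
  have "(\<Sum>A\<in>?G k. \<Sum>B\<in>?G (k + 1). (if A \<subseteq> B then 1 else 0) :: real)
      = (\<Sum>B\<in>?G (k + 1). \<Sum>A\<in>?G k. (if A \<subseteq> B then 1 else 0))"
    by (rule sum.swap)
  moreover have "(\<Sum>A\<in>?G k. \<Sum>B\<in>?G (k + 1). (if A \<subseteq> B then 1 else 0) :: real)
      = (\<Sum>A\<in>?G k. \<theta> (dim T - k))"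
  proof (rule sum.cong[OF refl])
    fix A assume A: "A \<in> ?G k"
    have "(\<Sum>B\<in>?G (k + 1). (if A \<subseteq> B then 1 else 0) :: real)
        = real (card {Y. subspace Y \<and> A \<subseteq> Y \<and> Y \<subseteq> T \<and> dim Y = dim A + 1})"
      using A by (simp add: sum.If_cases) (rule arg_cong[of _ _ card], auto)
    then show "(\<Sum>B\<in>?G (k + 1). (if A \<subseteq> B then 1 else 0) :: real) = \<theta> (dim T - k)"
      using card_one_step_extensions[of A T] A assms by simp
  qed
  moreover have "(\<Sum>B\<in>?G (k + 1). \<Sum>A\<in>?G k. (if A \<subseteq> B then 1 else 0) :: real)
      = (\<Sum>B\<in>?G (k + 1). \<theta> (k + 1))"
  proof (rule sum.cong[OF refl])
    fix B assume B: "B \<in> ?G (k + 1)"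
    have "(\<Sum>A\<in>?G k. (if A \<subseteq> B then 1 else 0) :: real)
        = real (card {H. subspace H \<and> H \<subseteq> B \<and> dim H + 1 = dim B})"
      using B by (simp add: sum.If_cases) (rule arg_cong[of _ _ card], auto)
    then show "(\<Sum>A\<in>?G k. (if A \<subseteq> B then 1 else 0) :: real) = \<theta> (k + 1)"
      using card_hyperplanes[of B] B assms by simp
  qed
  ultimately show ?thesis by simp
qed

text \<open>This is the Gaussian binomial coefficient, indexed by the codimension \<open>i\<close>.
  The induction lowers \<open>i\<close> while raising \<open>t\<close>, keeping \<open>T\<close>
  fixed.\<close>

lemma card_subspaces_of_dim:
  assumes "subspace T" "dim T = t + i"
  shows "real (card {S. subspace S \<and> S \<subseteq> T \<and> dim S = t}) = (\<Prod>j=1..i. \<theta> (t + j) / \<theta> j)"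
  using assms(2)
proof (induction i arbitrary: t)
  case 0
  have "S = T" if "subspace S" "S \<subseteq> T" "dim S = t" for S
    using subspace_dim_equal[of S T] that assms(1) 0 by simp
  then have "{S. subspace S \<and> S \<subseteq> T \<and> dim S = t} = {T}"
    using assms(1) 0 by auto
  then show ?case by simp
next
  case (Suc i)
  have "real (card {S. subspace S \<and> S \<subseteq> T \<and> dim S = t}) * \<theta> (Suc i)
      = (\<Prod>j=1..i. \<theta> (Suc t + j) / \<theta> j) * \<theta> (t + 1)"
    using card_subspaces_step[of T t] Suc.IH[of "Suc t"] Suc.prems assms(1) by simp
  then have "real (card {S. subspace S \<and> S \<subseteq> T \<and> dim S = t})
      = (\<Prod>j=1..i. \<theta> (Suc t + j) / \<theta> j) * \<theta> (t + 1) / \<theta> (Suc i)"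
    using theta_pos[of "Suc i"] by (subst nonzero_eq_divide_eq) simp_all
  also have "\<dots> = (\<Prod>j=1..i. \<theta> (Suc t + j)) * \<theta> (t + 1) / ((\<Prod>j=1..i. \<theta> j) * \<theta> (Suc i))"
    by (simp add: prod_dividef)
  finally have "real (card {S. subspace S \<and> S \<subseteq> T \<and> dim S = t})
      = (\<Prod>j=1..i. \<theta> (Suc t + j)) * \<theta> (t + 1) / ((\<Prod>j=1..i. \<theta> j) * \<theta> (Suc i))" .
  moreover have "(\<Prod>j=1..i. \<theta> (Suc t + j)) * \<theta> (t + 1) = (\<Prod>j=1..Suc i. \<theta> (t + j))"
  proof -
    have "(\<Prod>j=1..Suc i. \<theta> (t + j)) = \<theta> (t + 1) * (\<Prod>j=Suc 1..Suc i. \<theta> (t + j))"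
      by (subst prod.atLeast_Suc_atMost) auto
    then show ?thesis
      by (simp only: prod.shift_bounds_cl_Suc_ivl) (simp add: mult.commute)
  qed
  ultimately show ?case
    by (simp add: prod_dividef)
qed

declare dim_UNIV [simp del]

lemma proper_subspaces_not_cover:
  assumes "subspace A" "subspace B" "A \<noteq> UNIV" "B \<noteq> UNIV"
  shows "\<exists>v. v \<notin> A \<and> v \<notin> B"
proof (cases "A \<subseteq> B \<or> B \<subseteq> A")
  case True
  then show ?thesis using assms by blast
next
  case False
  then obtain a b where ab: "a \<in> A" "a \<notin> B" "b \<in> B" "b \<notin> A" by blast
  have "a + b \<notin> A" using ab assms subspace_diff[of A "a + b" a] by auto
  moreover have "a + b \<notin> B" using ab assms subspace_diff[of B "a + b" b] by auto
  ultimately show ?thesis by blast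
qed

lemma dim_span_Un_gt:
  assumes "subspace A" "\<not> X \<subseteq> A"
  shows "dim A < dim (span (X \<union> A))"
proof (rule dim_psubset)
  have "A \<subset> span (X \<union> A)"
    using assms span_superset[of "X \<union> A"] by auto
  then show "span A \<subset> span (span (X \<union> A))"
    using assms by (simp add: span_span)
qed

end

section \<open>Complements of a fixed subspace\<close>

locale attenuated_space = finite_field_vector_space +
  fixes W :: "'b set" and n l :: nat
  assumes subspace_W: "subspace W" and dim_W: "dim W = l" and dim_V: "dim UNIV = n + l"
begin

text \<open>Since \<open>dim UNIV = n + l\<close>, trivial intersection with \<open>W\<close> makes
  these direct complements of \<open>W\<close>; they are the \<open>(n,0)\<close>-subspaces of the
  theorem.\<close>

definition complements :: "'b set set" where
  "complements = {F. subspace F \<and> dim F = n \<and> F \<inter> W = {0}}"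

lemma card_complements_containing:
  assumes "subspace P" "P \<inter> W = {0}"
  shows "card {F \<in> complements. P \<subseteq> F} = q ^ (l * (n - dim P))"
proof -
  have "{F \<in> complements. P \<subseteq> F}
      = {F. subspace F \<and> P \<subseteq> F \<and> F \<subseteq> UNIV \<and> F \<inter> W = {0} \<and> dim F + dim W = dim UNIV}"
    by (auto simp: complements_def dim_W dim_V)
  then show ?thesis
    using card_complements[of UNIV W P] assms subspace_W by (simp add: dim_W dim_V)
qed

lemma Int_W_trivial_subset: "P \<inter> W = {0} \<Longrightarrow> subspace S \<Longrightarrow> S \<subseteq> P \<Longrightarrow> S \<inter> W = {0}"
  using subspace_0[of S] subspace_0[OF subspace_W] by blast

lemma dim_le_n_if_trivial:
  assumes "subspace P" "P \<inter> W = {0}"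
  shows "dim P \<le> n"
  using dim_Int_ge[of P W UNIV] assms subspace_W by (simp add: dim_W dim_V)

text \<open>As long as \<open>dim T < n\<close>, both \<open>T + W\<close> and \<open>T + S\<close>
  are proper because \<open>W\<close> and \<open>S\<close> have dimension at most \<open>l\<close>.
  A vector outside both can be adjoined to \<open>T\<close> without changing either trace.\<close>

lemma exists_complement_in_general_position:
  assumes "subspace T" "T \<inter> W = {0}" "subspace S" "dim S \<le> l"
  shows "\<exists>F\<in>complements. T \<subseteq> F \<and> F \<inter> S = T \<inter> S"
  using assms(1,2)
proof (induction "n - dim T" arbitrary: T)
  case 0
  then have "dim T = n" using dim_le_n_if_trivial[of T] by simp
  then show ?case using 0 by (intro bexI[of _ T]) (auto simp: complements_def)
next
  case (Suc d)
  have "dim (span (T \<union> W)) < n + l" "dim (span (T \<union> S)) < n + l"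
    using dim_Un_Int[of T W] dim_Un_Int[of T S] Suc.prems Suc.hyps(2) assms(3,4) subspace_W
    by (auto simp: dim_W)
  then have "span (T \<union> W) \<noteq> UNIV" "span (T \<union> S) \<noteq> UNIV"
    by (auto simp: dim_V simp del: dim_span)
  then obtain v where v: "v \<notin> span (T \<union> W)" "v \<notin> span (T \<union> S)"
    using proper_subspaces_not_cover[of "span (T \<union> W)" "span (T \<union> S)"] by auto
  then have "v \<notin> T" by (meson UnI1 span_base)
  then have "dim (span (insert v T)) = dim T + 1"
    using dim_span_insert Suc.prems(1) by blast
  moreover have "span (insert v T) \<inter> W = {0}"
    using span_insert_subspace_Int[of T W v] v Suc.prems subspace_W by simp
  moreover have "span (insert v T) \<inter> S = T \<inter> S"
    using span_insert_subspace_Int[of T S v] v Suc.prems assms(3) by simp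
  moreover have "d = n - dim (span (insert v T))"
    using Suc.hyps(2) \<open>dim (span (insert v T)) = dim T + 1\<close> by linarith
  ultimately have "\<exists>F\<in>complements. span (insert v T) \<subseteq> F \<and> F \<inter> S = span (insert v T) \<inter> S"
    by (intro Suc.hyps(1) subspace_span)
  then obtain F where "F \<in> complements" "span (insert v T) \<subseteq> F" "F \<inter> S = T \<inter> S"
    using \<open>span (insert v T) \<inter> S = T \<inter> S\<close> by auto
  moreover have "T \<subseteq> span (insert v T)"
    using span_superset[of "insert v T"] by simp
  ultimately show ?case
    by (intro bexI[of _ F] conjI) simp_all
qed

end

section \<open>Covers of an intersecting family\<close>

locale nontrivial_intersecting_family = attenuated_space +
  fixes t :: nat and \<F> :: "'b set set"
  assumes family: "\<F> \<subseteq> complements"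
    and intersecting: "A \<in> \<F> \<Longrightarrow> B \<in> \<F> \<Longrightarrow> t \<le> dim (A \<inter> B)"
    and Inter_family: "dim (\<Inter>\<F>) < t"
    and t_less_n: "t + 2 \<le> n" and n_le_l: "n + t + 2 \<le> l"
begin

section \<open>Covers, and branching from subspaces that are not covers\<close>

definition cover :: "'b set \<Rightarrow> bool" where
  "cover T \<longleftrightarrow> subspace T \<and> T \<inter> W = {0} \<and> (\<forall>F\<in>\<F>. t \<le> dim (T \<inter> F))"

lemma family_memD: "F \<in> \<F> \<Longrightarrow> subspace F" "F \<in> \<F> \<Longrightarrow> dim F = n" "F \<in> \<F> \<Longrightarrow> F \<inter> W = {0}"
  using family by (auto simp: complements_def)

lemma family_nonempty: "\<F> \<noteq> {}"
  using Inter_family dim_V t_less_n by auto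

lemma cover_if_family: "F \<in> \<F> \<Longrightarrow> cover F"
  using family_memD intersecting by (auto simp: cover_def)

text \<open>A cover of dimension at most \<open>t\<close> coincides with its trace on every member
  and so lies in \<open>\<Inter>\<F>\<close>. Its dimension would be at least \<open>t\<close> as a
  cover and less than \<open>t\<close> by non-triviality.\<close>

lemma cover_dim:
  assumes "cover T"
  shows "t < dim T"
proof (rule ccontr)
  assume "\<not> t < dim T"
  have "T \<subseteq> F" if "F \<in> \<F>" for F
  proof -
    have "t \<le> dim (T \<inter> F)" "subspace T" "subspace (T \<inter> F)"
      using assms that family_memD(1) by (auto simp: cover_def intro: subspace_inter)
    then have "T \<inter> F = T"
      using subspace_dim_equal[of "T \<inter> F" T] \<open>\<not> t < dim T\<close> by simp
    then show ?thesis by auto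
  qed
  then have "T \<subseteq> \<Inter>\<F>" by blast
  then have "dim T < t"
    using dim_subset Inter_family by (meson le_less_trans)
  moreover obtain F where "F \<in> \<F>" using family_nonempty by auto
  then have "t \<le> dim T"
    using assms dim_subset[of "T \<inter> F" T] by (force simp: cover_def)
  ultimately show False by simp
qed

lemma card_containing_le:
  assumes "subspace P"
  shows "card {F \<in> \<F>. P \<subseteq> F} \<le> q ^ (l * (n - dim P))"
proof (cases "P \<inter> W = {0}")
  case True
  then show ?thesis
    using card_mono[of "{F \<in> complements. P \<subseteq> F}" "{F \<in> \<F>. P \<subseteq> F}"] family
      card_complements_containing[OF assms True] by auto
next
  case False
  then have "{F \<in> \<F>. P \<subseteq> F} = {}"
    using Int_W_trivial_subset[OF _ assms] family_memD(3) by blast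
  then show ?thesis by (simp only: card.empty)
qed

text \<open>One branching step. The \<open>Y\<close> are spans of \<open>X\<close> with one-step
  extensions of \<open>X \<inter> F'\<close>; taking these inside a subspace \<open>U\<close> of
  \<open>F'\<close>, not in all of \<open>F'\<close>, makes their number independent of
  \<open>dim (X \<inter> F')\<close>.\<close>

lemma noncover_extensions:
  assumes "subspace X" "X \<inter> W = {0}" "\<not> cover X"
  obtains \<Y> where "real (card \<Y>) \<le> \<theta> (n - t + 1)"
    and "\<And>Y. Y \<in> \<Y> \<Longrightarrow> subspace Y \<and> X \<subseteq> Y \<and> dim Y = dim X + 1"
    and "\<And>F. F \<in> \<F> \<Longrightarrow> X \<subseteq> F \<Longrightarrow> \<exists>Y\<in>\<Y>. Y \<subseteq> F"
proof -
  obtain F' where F': "F' \<in> \<F>" "dim (X \<inter> F') < t"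
    using assms by (auto simp: cover_def not_le)
  define s where "s = dim (X \<inter> F')"
  have sub: "subspace F'" "subspace (X \<inter> F')" "dim F' = n"
    using F' assms family_memD by (auto intro: subspace_inter)
  \<comment> \<open>Members through \<open>X\<close> meet \<open>F'\<close> in dimension at least \<open>t\<close>, so a subspace of \<open>F'\<close> of
    codimension \<open>t - s - 1\<close> already meets them outside \<open>X\<close>.\<close>
  have "s \<le> n - t + s + 1" "n - t + s + 1 \<le> n"
    using F'(2) t_less_n by (auto simp: s_def)
  then obtain U where U: "subspace U" "X \<inter> F' \<subseteq> U" "U \<subseteq> F'" "dim U = n - t + s + 1"
    using subspace_extend_within[of "X \<inter> F'" F' "n - t + s + 1"] sub
    by (auto simp: s_def)
  define \<Y>' where "\<Y>' = {Y. subspace Y \<and> X \<inter> F' \<subseteq> Y \<and> Y \<subseteq> U \<and> dim Y = dim (X \<inter> F') + 1}"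
  define \<Y> where "\<Y> = (\<lambda>Y. span (X \<union> Y)) ` \<Y>'"
  have "real (card \<Y>') = \<theta> (n - t + 1)"
    using card_one_step_extensions[of "X \<inter> F'" U] U sub by (simp add: \<Y>'_def s_def)
  then have "real (card \<Y>) \<le> \<theta> (n - t + 1)"
    using card_image_le[of \<Y>' "\<lambda>Y. span (X \<union> Y)"] by (simp add: \<Y>_def)
  moreover have "subspace Y \<and> X \<subseteq> Y \<and> dim Y = dim X + 1" if "Y \<in> \<Y>" for Y
  proof -
    obtain Y' where Y': "Y = span (X \<union> Y')" "subspace Y'" "X \<inter> F' \<subseteq> Y'" "Y' \<subseteq> U"
        "dim Y' = dim (X \<inter> F') + 1"
      using \<open>Y \<in> \<Y>\<close> by (auto simp: \<Y>_def \<Y>'_def)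
    then have "X \<inter> Y' = X \<inter> F'" using U by blast
    then have "dim Y = dim X + 1"
      using dim_Un_Int[of X Y'] Y' assms by simp
    then show ?thesis
      using Y' span_superset[of "X \<union> Y'"] by auto
  qed
  moreover have "\<exists>Y\<in>\<Y>. Y \<subseteq> F" if F: "F \<in> \<F>" "X \<subseteq> F" for F
  proof -
    have "subspace (F \<inter> F')"
      using F(1) family_memD(1) sub(1) by (auto intro: subspace_inter)
    have "t + dim U \<le> dim (F \<inter> F') + dim U"
      using intersecting[OF F(1) F'(1)] by simp
    also have "\<dots> \<le> dim (F \<inter> F' \<inter> U) + n"
      using dim_Int_ge[OF \<open>subspace (F \<inter> F')\<close> U(1) sub(1)] U(3) sub(3) by simp
    also have "F \<inter> F' \<inter> U = F \<inter> U" using U by blast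
    finally have "dim (X \<inter> F') + 1 \<le> dim (F \<inter> U)"
      using U t_less_n by (simp add: s_def)
    moreover have "X \<inter> F' \<subseteq> F \<inter> U" using F U by auto
    ultimately obtain Y' where Y': "subspace Y'" "X \<inter> F' \<subseteq> Y'" "Y' \<subseteq> F \<inter> U" "dim Y' = dim (X \<inter> F') + 1"
      using subspace_extend_within[of "X \<inter> F'" "F \<inter> U" "dim (X \<inter> F') + 1"] sub U F family_memD
      by (metis le_add1 subspace_inter)
    then have "span (X \<union> Y') \<in> \<Y>" by (auto simp: \<Y>_def \<Y>'_def)
    moreover have "span (X \<union> Y') \<subseteq> F"
      using F Y' family_memD by (intro span_minimal) auto
    ultimately show ?thesis by blast
  qed
  ultimately show ?thesis using that by blast
qed

lemma card_le_sum_of_parts: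
  assumes "real (card \<Y>) \<le> c" "0 \<le> b"
    and "\<And>Y. Y \<in> \<Y> \<Longrightarrow> real (card {F \<in> \<G>. Y \<subseteq> F}) \<le> b"
    and "\<And>F. F \<in> \<G> \<Longrightarrow> \<exists>Y\<in>\<Y>. Y \<subseteq> F"
  shows "real (card (\<G> :: 'b set set)) \<le> c * b"
proof -
  have "\<G> \<subseteq> (\<Union>Y\<in>\<Y>. {F \<in> \<G>. Y \<subseteq> F})"
    using assms(4) by blast
  then have "card \<G> \<le> card (\<Union>Y\<in>\<Y>. {F \<in> \<G>. Y \<subseteq> F})"
    by (intro card_mono) auto
  also have "\<dots> \<le> (\<Sum>Y\<in>\<Y>. card {F \<in> \<G>. Y \<subseteq> F})"
    by (intro card_UN_le) auto
  finally have "real (card \<G>) \<le> (\<Sum>Y\<in>\<Y>. real (card {F \<in> \<G>. Y \<subseteq> F}))"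
    by (metis of_nat_le_iff of_nat_sum)
  also have "\<dots> \<le> (\<Sum>Y\<in>\<Y>. b)"
    using assms(3) by (rule sum_mono)
  also have "\<dots> \<le> c * b"
    using assms(1,2) by (simp add: mult_right_mono)
  finally show ?thesis .
qed

text \<open>The branching step as an inequality; extensions that meet \<open>W\<close> nontrivially
  lie in no member and cost nothing. The subfamily \<open>\<G>\<close> allows counting only the
  members that contain no minimal cover, while \<open>cover\<close> still refers to
  \<open>\<F>\<close>.\<close>

lemma card_containing_noncover_le:
  assumes "subspace X" "X \<inter> W = {0}" "\<not> cover X" "\<G> \<subseteq> \<F>" "0 \<le> b"
    and "\<And>Y. subspace Y \<Longrightarrow> Y \<inter> W = {0} \<Longrightarrow> X \<subseteq> Y \<Longrightarrow> dim Y = dim X + 1 \<Longrightarrow>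
      real (card {F \<in> \<G>. Y \<subseteq> F}) \<le> b"
  shows "real (card {F \<in> \<G>. X \<subseteq> F}) \<le> \<theta> (n - t + 1) * b"
proof -
  obtain \<Y> where \<Y>: "real (card \<Y>) \<le> \<theta> (n - t + 1)"
      "\<And>Y. Y \<in> \<Y> \<Longrightarrow> subspace Y \<and> X \<subseteq> Y \<and> dim Y = dim X + 1"
      "\<And>F. F \<in> \<F> \<Longrightarrow> X \<subseteq> F \<Longrightarrow> \<exists>Y\<in>\<Y>. Y \<subseteq> F"
    using noncover_extensions[OF assms(1-3)] by metis
  show ?thesis
  proof (rule card_le_sum_of_parts[OF \<Y>(1) assms(5)])
    fix Y assume Y: "Y \<in> \<Y>"
    show "real (card {F \<in> {F \<in> \<G>. X \<subseteq> F}. Y \<subseteq> F}) \<le> b"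
    proof (cases "Y \<inter> W = {0}")
      case True
      have "{F \<in> {F \<in> \<G>. X \<subseteq> F}. Y \<subseteq> F} = {F \<in> \<G>. Y \<subseteq> F}"
        using \<Y>(2)[OF Y] by blast
      then show ?thesis using assms(6)[of Y] \<Y>(2)[OF Y] True by simp
    next
      case False
      then have "{F \<in> {F \<in> \<G>. X \<subseteq> F}. Y \<subseteq> F} = {}"
        using Int_W_trivial_subset[of _ Y] \<Y>(2)[OF Y] family_memD(3) assms(4) by blast
      then show ?thesis using assms(5) by (simp only: card.empty of_nat_0)
    qed
  next
    fix F assume "F \<in> {F \<in> \<G>. X \<subseteq> F}"
    then show "\<exists>Y\<in>\<Y>. Y \<subseteq> F" using \<Y>(3) assms(4) by blast
  qed
qed

text \<open>Below dimension \<open>j\<close> nothing is a cover, so branching can be repeated until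
  dimension \<open>j\<close>, where only the count of all complements through a
  \<open>j\<close>-space is left.\<close>

lemma card_containing_below_covers_le:
  assumes "subspace X" "X \<inter> W = {0}" "dim X \<le> j"
    and "\<And>Y. cover Y \<Longrightarrow> j \<le> dim Y"
  shows "real (card {F \<in> \<F>. X \<subseteq> F}) \<le> \<theta> (n - t + 1) ^ (j - dim X) * real q ^ (l * (n - j))"
  using assms(1-3)
proof (induction "j - dim X" arbitrary: X)
  case 0
  then have "dim X = j" by simp
  then show ?case
    using card_containing_le[of X] 0 by (simp flip: of_nat_power)
next
  case (Suc d)
  have "real (card {F \<in> \<F>. X \<subseteq> F}) \<le> \<theta> (n - t + 1) * (\<theta> (n - t + 1) ^ d * real q ^ (l * (n - j)))"
  proof (rule card_containing_noncover_le)
    show "\<not> cover X"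
      using assms(4)[of X] Suc.hyps(2) by auto
    fix Y assume Y: "subspace Y" "Y \<inter> W = {0}" "dim Y = dim X + 1"
    then have "d = j - dim Y" "dim Y \<le> j"
      using Suc.hyps(2) by linarith+
    then show "real (card {F \<in> \<F>. Y \<subseteq> F}) \<le> \<theta> (n - t + 1) ^ d * real q ^ (l * (n - j))"
      using Suc.hyps(1)[of Y] Y by blast
  qed (use Suc.prems theta_nonneg in auto)
  moreover have "j - dim X = Suc d"
    using Suc.hyps(2) by simp
  ultimately show ?case
    by (simp only: power_Suc mult.assoc)
qed

text \<open>Each member contains a \<open>t\<close>-subspace of the cover \<open>T\<close>. The
  product counts these subspaces, and from each one branching continues up to dimension
  \<open>t + i\<close>.\<close>

lemma card_le_minimal_cover:
  assumes "cover T" "dim T = t + i" "\<And>Y. cover Y \<Longrightarrow> t + i \<le> dim Y"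
  shows "real (card \<F>)
    \<le> (\<Prod>j=1..i. \<theta> (t + j) / \<theta> j) * (\<theta> (n - t + 1) ^ i * real q ^ (l * (n - t - i)))"
proof (rule card_le_sum_of_parts)
  have T: "subspace T" "T \<inter> W = {0}" using assms by (auto simp: cover_def)
  show "real (card {S. subspace S \<and> S \<subseteq> T \<and> dim S = t}) \<le> (\<Prod>j=1..i. \<theta> (t + j) / \<theta> j)"
    using card_subspaces_of_dim[OF T(1) assms(2)] by simp
  show "0 \<le> \<theta> (n - t + 1) ^ i * real q ^ (l * (n - t - i))"
    using theta_nonneg by simp
  fix S assume "S \<in> {S. subspace S \<and> S \<subseteq> T \<and> dim S = t}"
  then show "real (card {F \<in> \<F>. S \<subseteq> F}) \<le> \<theta> (n - t + 1) ^ i * real q ^ (l * (n - t - i))"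
    using card_containing_below_covers_le[of S "t + i"] assms(3) Int_W_trivial_subset[OF T(2)] by simp
next
  fix F assume F: "F \<in> \<F>"
  have "subspace (T \<inter> F)" using assms F family_memD by (auto simp: cover_def intro: subspace_inter)
  moreover have "t \<le> dim (T \<inter> F)" using assms F by (auto simp: cover_def)
  ultimately obtain S where "subspace S" "S \<subseteq> T \<inter> F" "dim S = t"
    using choose_subspace_of_subspace[of t "T \<inter> F"] by auto
  then show "\<exists>Y\<in>{S. subspace S \<and> S \<subseteq> T \<and> dim S = t}. Y \<subseteq> F" by blast
qed

section \<open>Covers of the least possible dimension and the structure of maximal families\<close>

definition min_covers :: "'b set set" where
  "min_covers = {T. cover T \<and> dim T = t + 1}"

text \<open>Members containing a minimal cover are counted cover by cover. Every other member
  contains a \<open>t\<close>-subspace of one fixed minimal cover, and two branching steps from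
  there reach dimension \<open>t + 2\<close>: the \<open>t\<close>-subspace is too small to be a
  cover, and \<open>(t + 1)\<close>-spaces that are covers contribute nothing.\<close>

lemma card_le_min_covers:
  assumes "min_covers \<noteq> {}"
  shows "real (card \<F>) \<le> real (card min_covers) * real q ^ (l * (n - t - 1))
    + \<theta> (t + 1) * (\<theta> (n - t + 1) * (\<theta> (n - t + 1) * real q ^ (l * (n - t - 2))))"
proof -
  define \<A> where "\<A> = {F \<in> \<F>. \<exists>T\<in>min_covers. T \<subseteq> F}"
  define \<B> where "\<B> = {F \<in> \<F>. \<not> (\<exists>T\<in>min_covers. T \<subseteq> F)}"
  have "real (card \<A>) \<le> real (card min_covers) * real q ^ (l * (n - t - 1))"
  proof (rule card_le_sum_of_parts)
    fix T assume T: "T \<in> min_covers"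
    have "card {F \<in> \<A>. T \<subseteq> F} \<le> card {F \<in> \<F>. T \<subseteq> F}"
      by (rule card_mono) (auto simp: \<A>_def)
    then have "card {F \<in> \<A>. T \<subseteq> F} \<le> q ^ (l * (n - t - 1))"
      using card_containing_le[of T] T by (force simp: min_covers_def cover_def)
    then show "real (card {F \<in> \<A>. T \<subseteq> F}) \<le> real q ^ (l * (n - t - 1))"
      by (simp flip: of_nat_power)
  qed (auto simp: \<A>_def)
  moreover have "real (card \<B>)
      \<le> \<theta> (t + 1) * (\<theta> (n - t + 1) * (\<theta> (n - t + 1) * real q ^ (l * (n - t - 2))))"
  proof -
    obtain T where T: "T \<in> min_covers" using assms by auto
    then have T': "subspace T" "T \<inter> W = {0}" "dim T = t + 1"
      by (auto simp: min_covers_def cover_def)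
    show ?thesis
    proof (rule card_le_sum_of_parts)
      show "real (card {S. subspace S \<and> S \<subseteq> T \<and> dim S + 1 = dim T}) \<le> \<theta> (t + 1)"
        using card_hyperplanes[of T] T' by simp
      fix S assume S: "S \<in> {S. subspace S \<and> S \<subseteq> T \<and> dim S + 1 = dim T}"
      show "real (card {F \<in> \<B>. S \<subseteq> F}) \<le> \<theta> (n - t + 1) * (\<theta> (n - t + 1) * real q ^ (l * (n - t - 2)))"
      proof (rule card_containing_noncover_le)
        show "subspace S" "S \<inter> W = {0}" "\<not> cover S"
          using S T' Int_W_trivial_subset[of T S] cover_dim[of S] by auto
        fix Y assume Y: "subspace Y" "Y \<inter> W = {0}" "dim Y = dim S + 1"
        show "real (card {F \<in> \<B>. Y \<subseteq> F}) \<le> \<theta> (n - t + 1) * real q ^ (l * (n - t - 2))"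
        proof (cases "cover Y")
          case True
          \<comment> \<open>Such a \<open>Y\<close> is itself a minimal cover, and all members
            through it belong to \<open>\<A>\<close>.\<close>
          then have "{F \<in> \<B>. Y \<subseteq> F} = {}"
            using Y S T' by (auto simp: \<B>_def min_covers_def)
          then show ?thesis using theta_nonneg by (simp only: card.empty) simp
        next
          case False
          show ?thesis
          proof (rule card_containing_noncover_le[OF Y(1,2) False])
            fix Y' assume Y': "subspace Y'" "dim Y' = dim Y + 1"
            have "card {F \<in> \<B>. Y' \<subseteq> F} \<le> card {F \<in> \<F>. Y' \<subseteq> F}"
              by (rule card_mono) (auto simp: \<B>_def)
            moreover have "dim Y' = t + 2" using Y' Y S T' by simp
            ultimately have "card {F \<in> \<B>. Y' \<subseteq> F} \<le> q ^ (l * (n - t - 2))"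
              using card_containing_le[of Y'] Y' by fastforce
            then show "real (card {F \<in> \<B>. Y' \<subseteq> F}) \<le> real q ^ (l * (n - t - 2))"
              by (simp flip: of_nat_power)
          qed (auto simp: \<B>_def)
        qed
      qed (use theta_nonneg in \<open>auto simp: \<B>_def\<close>)
    next
      fix F assume "F \<in> \<B>"
      then have F: "F \<in> \<F>" by (simp add: \<B>_def)
      have "subspace (T \<inter> F)" using T' F family_memD by (auto intro: subspace_inter)
      moreover have "t \<le> dim (T \<inter> F)" using T F by (auto simp: min_covers_def cover_def)
      ultimately obtain S where "subspace S" "S \<subseteq> T \<inter> F" "dim S = t"
        using choose_subspace_of_subspace[of t "T \<inter> F"] by auto
      then show "\<exists>Y\<in>{S. subspace S \<and> S \<subseteq> T \<and> dim S + 1 = dim T}. Y \<subseteq> F"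
        using T' by auto
    qed (use theta_nonneg in auto)
  qed
  moreover have "card \<F> \<le> card \<A> + card \<B>"
  proof -
    have "\<F> = \<A> \<union> \<B>" by (auto simp: \<A>_def \<B>_def)
    then show ?thesis using card_Un_le[of \<A> \<B>] by simp
  qed
  ultimately show ?thesis by linarith
qed

lemma min_coversD:
  assumes "T \<in> min_covers"
  shows "subspace T" "T \<inter> W = {0}" "dim T = t + 1" "F \<in> \<F> \<Longrightarrow> t \<le> dim (T \<inter> F)"
  using assms by (auto simp: min_covers_def cover_def)

text \<open>A complement through \<open>T1\<close> in general position to \<open>T2\<close> meets
  every member well enough, since \<open>T1\<close> is a cover, and so belongs to the family by
  maximality. Being a cover, \<open>T2\<close> then meets it in dimension at least \<open>t\<close>,
  and this intersection is \<open>T1 \<inter> T2\<close>.\<close>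

lemma min_covers_intersecting:
  assumes maximal: "\<forall>A\<in>complements. (\<forall>B\<in>\<F>. t \<le> dim (A \<inter> B)) \<longrightarrow> A \<in> \<F>"
    and "T1 \<in> min_covers" "T2 \<in> min_covers"
  shows "t \<le> dim (T1 \<inter> T2)"
proof -
  note T = min_coversD[OF assms(2)] min_coversD[OF assms(3)]
  obtain F where F: "F \<in> complements" "T1 \<subseteq> F" "F \<inter> T2 = T1 \<inter> T2"
    using exists_complement_in_general_position[of T1 T2] T n_le_l by auto
  have "F \<in> \<F>"
  proof (rule maximal[rule_format, OF F(1)])
    fix B assume "B \<in> \<F>"
    then have "t \<le> dim (T1 \<inter> B)" using T by blast
    also have "\<dots> \<le> dim (F \<inter> B)" using F by (intro dim_subset) auto
    finally show "t \<le> dim (F \<inter> B)" .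
  qed
  then show ?thesis
    using T(8) F by (metis Int_commute)
qed

text \<open>The third cover is spanned by its traces on \<open>T1\<close> and \<open>T2\<close>,
  hence lies in their span. A member meeting this span in dimension at most \<open>t\<close> would
  have the same trace on all three covers; that trace would be \<open>T1 \<inter> T2\<close>, which
  \<open>T3\<close> does not contain.\<close>

lemma min_covers_not_through_common_subspace:
  assumes int: "\<forall>T1\<in>min_covers. \<forall>T2\<in>min_covers. t \<le> dim (T1 \<inter> T2)"
    and T: "T1 \<in> min_covers" "T2 \<in> min_covers" "T3 \<in> min_covers"
    and ne: "T1 \<noteq> T2" "\<not> T1 \<inter> T2 \<subseteq> T3"
  shows "dim (T1 \<union> T2) = t + 2" "F \<in> \<F> \<Longrightarrow> t + 1 \<le> dim (F \<inter> span (T1 \<union> T2))"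
proof -
  note D1 = min_coversD[OF T(1)] and D2 = min_coversD[OF T(2)] and D3 = min_coversD[OF T(3)]
  define X where "X = T1 \<inter> T2"
  have X: "subspace X" "X \<subseteq> T1" "X \<subseteq> T2"
    using D1 D2 by (auto simp: X_def intro: subspace_inter)
  have "dim X \<noteq> t + 1"
  proof
    assume "dim X = t + 1"
    then have "X = T1" "X = T2"
      using subspace_dim_equal[of X T1] subspace_dim_equal[of X T2] X D1 D2 by auto
    then show False using ne by simp
  qed
  moreover have "dim X \<le> t + 1" using X dim_subset[of X T1] D1 by simp
  moreover have "t \<le> dim X" using int T by (auto simp: X_def)
  ultimately have dX: "dim X = t" by simp
  then show d: "dim (T1 \<union> T2) = t + 2"
    using dim_Un_Int[of T1 T2] D1 D2 by (simp add: X_def)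
  let ?Z = "span (T1 \<union> T2)"
  have Z: "T1 \<subseteq> ?Z" "T2 \<subseteq> ?Z" using span_superset[of "T1 \<union> T2"] by auto
  have T3: "T3 \<subseteq> ?Z"
  proof -
    \<comment> \<open>An inclusion would place \<open>T3 \<inter> T1\<close> inside
      \<open>X\<close>, and comparing dimensions would give \<open>X \<subseteq> T3\<close>.\<close>
    have "\<not> T3 \<inter> T1 \<subseteq> T3 \<inter> T2"
    proof
      assume "T3 \<inter> T1 \<subseteq> T3 \<inter> T2"
      then have "T3 \<inter> T1 \<subseteq> X" by (auto simp: X_def)
      then have "T3 \<inter> T1 = X"
        using subspace_dim_equal[of "T3 \<inter> T1" X] X int[rule_format, OF T(3,1)] dX D1 D3
        by (auto intro: subspace_inter)
      then show False using ne by (auto simp: X_def)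
    qed
    then have "t + 1 \<le> dim (span ((T3 \<inter> T1) \<union> (T3 \<inter> T2)))"
      using dim_span_Un_gt[of "T3 \<inter> T2" "T3 \<inter> T1"] int[rule_format, OF T(3,2)] D2 D3
      by (simp add: subspace_inter)
    moreover have "span ((T3 \<inter> T1) \<union> (T3 \<inter> T2)) \<subseteq> T3"
      using D3 by (intro span_minimal) auto
    ultimately have "span ((T3 \<inter> T1) \<union> (T3 \<inter> T2)) = T3"
      using subspace_dim_equal[of "span ((T3 \<inter> T1) \<union> (T3 \<inter> T2))" T3] D3 by simp
    moreover have "span ((T3 \<inter> T1) \<union> (T3 \<inter> T2)) \<subseteq> ?Z"
      by (intro span_mono) auto
    ultimately show ?thesis by simp
  qed
  show "t + 1 \<le> dim (F \<inter> ?Z)" if F: "F \<in> \<F>"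
  proof (rule ccontr)
    assume "\<not> t + 1 \<le> dim (F \<inter> ?Z)"
    then have le: "dim (F \<inter> ?Z) \<le> t" by simp
    have sF: "subspace F" using F family_memD by simp
    \<comment> \<open>The trace of a cover already has dimension \<open>t\<close>, which leaves no
      room in \<open>F \<inter> ?Z\<close> for anything more.\<close>
    have eq: "T \<inter> F = F \<inter> ?Z" if "T \<in> min_covers" "T \<subseteq> ?Z" for T
    proof (rule subspace_dim_equal)
      show "subspace (T \<inter> F)" "subspace (F \<inter> ?Z)" "T \<inter> F \<subseteq> F \<inter> ?Z"
        using min_coversD[OF that(1)] sF that by (auto intro: subspace_inter)
      show "dim (F \<inter> ?Z) \<le> dim (T \<inter> F)"
        using min_coversD(4)[OF that(1) F] le by simp
    qed
    have "F \<inter> ?Z \<subseteq> X"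
      using eq[OF T(1) Z(1)] eq[OF T(2) Z(2)] by (auto simp: X_def)
    then have "F \<inter> ?Z = X"
      using subspace_dim_equal[of "F \<inter> ?Z" X] X sF dX D1(4)[OF F] eq[OF T(1) Z(1)]
      by (auto intro: subspace_inter)
    then show False using eq[OF T(3) T3] ne by (auto simp: X_def)
  qed
qed

text \<open>If a member \<open>F\<close> does not contain \<open>X\<close>, a minimal cover
  \<open>T\<close> satisfies \<open>T = X + (T \<inter> F)\<close> and so lies in
  \<open>X + F\<close>. The two outcomes correspond to whether this sum is the same for all such
  \<open>F\<close>.\<close>

lemma family_through_common_subspace:
  assumes ne: "min_covers \<noteq> {}"
    and X: "subspace X" "dim X = t" "\<forall>T\<in>min_covers. X \<subseteq> T"
  obtains M where "subspace M" "dim M = n + 1" "dim (M \<inter> W) = 1" "X \<subseteq> M"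
      "\<F> \<subseteq> {F \<in> complements. X \<subseteq> F \<and> t + 1 \<le> dim (F \<inter> M)} \<union> {F \<in> complements. F \<subseteq> M}"
  | "real (card min_covers) \<le> \<theta> (n - t)"
proof -
  have key: "T \<subseteq> span (X \<union> F) \<and> dim (span (X \<union> F)) = n + 1"
    if F: "F \<in> \<F>" "\<not> X \<subseteq> F" and T: "T \<in> min_covers" for F T
  proof -
    note D = min_coversD[OF T]
    have sF: "subspace F" "dim F = n" using F family_memD by auto
    have sTF: "subspace (T \<inter> F)" using D sF by (auto intro: subspace_inter)
    have "dim (T \<inter> F) < dim (span (X \<union> (T \<inter> F)))"
      using F sTF by (intro dim_span_Un_gt) auto
    moreover have sub: "span (X \<union> (T \<inter> F)) \<subseteq> T"
      using X T D by (intro span_minimal) auto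
    moreover note dim_subset[OF sub] D(3) D(4)[OF F(1)]
    ultimately have dTF: "dim (T \<inter> F) = t" and "dim T \<le> dim (span (X \<union> (T \<inter> F)))"
      by linarith+
    then have eq: "span (X \<union> (T \<inter> F)) = T"
      using subspace_dim_equal[of "span (X \<union> (T \<inter> F))" T] D(1) sub by blast
    have "X \<inter> (T \<inter> F) = X \<inter> F" using X(3)[rule_format, OF T] by blast
    \<comment> \<open>The dimension formula inside \<open>T\<close> forces
      \<open>dim (X \<inter> F) = t - 1\<close>, so \<open>X + F\<close> has dimension exactly
      \<open>n + 1\<close>.\<close>
    then have "dim (X \<inter> F) + (t + 1) = t + t"
      using dim_Un_Int[OF X(1) sTF] eq dTF X(2) D(3) by (metis add.commute dim_span)
    then have "dim (X \<union> F) = n + 1"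
      using dim_Un_Int[OF X(1) sF(1)] X(2) sF(2) by simp
    moreover have "T \<subseteq> span (X \<union> F)"
      using eq span_mono[of "X \<union> (T \<inter> F)" "X \<union> F"] by auto
    ultimately show ?thesis by simp
  qed
  have "\<not> X \<subseteq> \<Inter>\<F>"
    using dim_subset[of X "\<Inter>\<F>"] X Inter_family by auto
  then obtain F0 where F0: "F0 \<in> \<F>" "\<not> X \<subseteq> F0" by blast
  obtain T0 where T0: "T0 \<in> min_covers" using ne by auto
  define M where "M = span (X \<union> F0)"
  have M: "subspace M" "dim M = n + 1" "X \<subseteq> M" "F0 \<subseteq> M"
    using key[OF F0 T0] span_superset[of "X \<union> F0"] by (auto simp: M_def)
  show ?thesis
  proof (cases "\<exists>F\<in>\<F>. \<not> X \<subseteq> F \<and> span (X \<union> F) \<noteq> M")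
    case True
    then obtain F where F: "F \<in> \<F>" "\<not> X \<subseteq> F" "span (X \<union> F) \<noteq> M" by blast
    define D where "D = span (X \<union> F) \<inter> M"
    have D: "subspace D" "X \<subseteq> D" "D \<subseteq> M" "D \<subseteq> span (X \<union> F)"
      using M span_superset[of "X \<union> F"] by (auto simp: D_def intro: subspace_inter)
    have "dim D \<noteq> n + 1"
      using subspace_dim_equal[of D M] subspace_dim_equal[of D "span (X \<union> F)"] D M F
        key[OF F(1,2) T0] by auto
    moreover have "dim D \<le> n + 1"
      using dim_subset[OF D(3)] M by simp
    ultimately have dD: "dim D \<le> n" by simp
    \<comment> \<open>All minimal covers are one-step extensions of \<open>X\<close> inside the
      intersection of two different \<open>(n + 1)\<close>-spaces, whose dimension is at most
      \<open>n\<close>.\<close>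
    have "min_covers \<subseteq> {Y. subspace Y \<and> X \<subseteq> Y \<and> Y \<subseteq> D \<and> dim Y = dim X + 1}"
      using key[OF F(1,2)] key[OF F0] min_coversD X by (auto simp: D_def M_def)
    then have "card min_covers \<le> card {Y. subspace Y \<and> X \<subseteq> Y \<and> Y \<subseteq> D \<and> dim Y = dim X + 1}"
      by (intro card_mono) auto
    then have "real (card min_covers) \<le> \<theta> (dim D - t)"
      using card_one_step_extensions[OF X(1) D(1,2)] X(2) by simp
    also have "\<dots> \<le> \<theta> (n - t)"
      using dD by (intro theta_mono) simp
    finally show ?thesis using that(2) by blast
  next
    case False
    have F0': "subspace F0" "dim F0 = n" "F0 \<inter> W = {0}" using F0 family_memD by auto
    \<comment> \<open>\<open>M\<close> contains the complement \<open>F0\<close> of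
      \<open>W\<close>, so \<open>M + W\<close> is the whole space and \<open>M\<close> meets
      \<open>W\<close> in a line.\<close>
    have "n + l = dim (F0 \<union> W)"
      using dim_Un_Int[of F0 W] F0' subspace_W by (simp add: dim_W)
    also have "\<dots> \<le> dim (M \<union> W)" using M by (intro dim_subset) auto
    finally have "dim (M \<union> W) = n + l"
      using dim_subset[of "M \<union> W" UNIV] by (simp add: dim_V)
    then have "dim (M \<inter> W) = 1"
      using dim_Un_Int[of M W] M subspace_W by (simp add: dim_W)
    moreover have "F \<in> {F \<in> complements. X \<subseteq> F \<and> t + 1 \<le> dim (F \<inter> M)} \<union> {F \<in> complements. F \<subseteq> M}"
      if F: "F \<in> \<F>" for F
    proof (cases "X \<subseteq> F")
      case True
      have sF: "subspace F" using F family_memD by simp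
      \<comment> \<open>\<open>F0\<close> does not contain \<open>X\<close>, so adding
        \<open>X\<close> to \<open>F \<inter> F0\<close> gains a dimension without leaving
        \<open>F \<inter> M\<close>.\<close>
      have "dim (F \<inter> F0) < dim (span (X \<union> (F \<inter> F0)))"
        using F0 F0' sF by (intro dim_span_Un_gt) (auto intro: subspace_inter)
      also have "span (X \<union> (F \<inter> F0)) \<subseteq> F \<inter> M"
        using True M sF by (intro span_minimal subspace_inter) auto
      then have "dim (span (X \<union> (F \<inter> F0))) \<le> dim (F \<inter> M)" by (rule dim_subset)
      finally show ?thesis
        using intersecting[OF F F0(1)] True F family by auto
    next
      case nX: False
      then have "F \<subseteq> M"
        using False F span_superset[of "X \<union> F"] by auto
      then show ?thesis using F family by auto
    qed
    ultimately show ?thesis using that(1)[of M] M by blast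
  qed
qed

text \<open>Only \<open>shadow\<close> and \<open>hilton_milner\<close> record a containment in a
  candidate for an extremal family; the other outcomes are numerical bounds. The outcome
  \<open>shadow_meeting_W\<close> arises because the span of two minimal covers can meet
  \<open>W\<close> although the covers do not.\<close>

lemma maximal_family_structure:
  assumes maximal: "\<forall>A\<in>complements. (\<forall>B\<in>\<F>. t \<le> dim (A \<inter> B)) \<longrightarrow> A \<in> \<F>"
  obtains
    (shadow) Z where "subspace Z" "dim Z = t + 2" "Z \<inter> W = {0}"
      "\<F> \<subseteq> {F \<in> complements. t + 1 \<le> dim (F \<inter> Z)}"
  | (shadow_meeting_W) "real (card \<F>) \<le> real q ^ (t + 1) * real q ^ (l * (n - t - 1))"
  | (hilton_milner) X M where "subspace X" "dim X = t" "X \<inter> W = {0}"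
      "subspace M" "dim M = n + 1" "dim (M \<inter> W) = 1" "X \<subseteq> M"
      "\<F> \<subseteq> {F \<in> complements. X \<subseteq> F \<and> t + 1 \<le> dim (F \<inter> M)} \<union> {F \<in> complements. F \<subseteq> M}"
  | (few_covers) "real (card \<F>) \<le> \<theta> (n - t) * real q ^ (l * (n - t - 1))
      + \<theta> (t + 1) * (\<theta> (n - t + 1) * (\<theta> (n - t + 1) * real q ^ (l * (n - t - 2))))"
  | (large_covers) i where "2 \<le> i" "i \<le> n - t" "real (card \<F>)
      \<le> (\<Prod>j=1..i. \<theta> (t + j) / \<theta> j) * (\<theta> (n - t + 1) ^ i * real q ^ (l * (n - t - i)))"
proof (cases "min_covers = {}")
  case True
  have ex: "\<exists>d T. cover T \<and> dim T = d"
    using family_nonempty cover_if_family by blast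
  define d where "d = (LEAST d. \<exists>T. cover T \<and> dim T = d)"
  obtain T where T: "cover T" "dim T = d"
    using LeastI_ex[OF ex] by (auto simp: d_def)
  have least: "d \<le> dim Y" if "cover Y" for Y
    unfolding d_def by (rule Least_le) (use that in auto)
  have "d > t" using cover_dim T by auto
  moreover have "d \<noteq> t + 1" using T True by (auto simp: min_covers_def)
  moreover have "d \<le> n" using T dim_le_n_if_trivial by (auto simp: cover_def)
  ultimately have "2 \<le> d - t" "d - t \<le> n - t" "dim T = t + (d - t)" using T by auto
  moreover have "t + (d - t) \<le> dim Y" if "cover Y" for Y
    using least[OF that] \<open>d > t\<close> by simp
  ultimately show ?thesis
    using card_le_minimal_cover[OF T(1), of "d - t"] large_covers[of "d - t"] by simp
next
  case False
  have int: "\<forall>T1\<in>min_covers. \<forall>T2\<in>min_covers. t \<le> dim (T1 \<inter> T2)"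
    using min_covers_intersecting[OF maximal] by blast
  show ?thesis
  proof (cases "\<exists>T1\<in>min_covers. \<exists>T2\<in>min_covers. \<exists>T3\<in>min_covers. T1 \<noteq> T2 \<and> \<not> T1 \<inter> T2 \<subseteq> T3")
    case True
    then obtain T1 T2 T3 where T: "T1 \<in> min_covers" "T2 \<in> min_covers" "T3 \<in> min_covers"
        "T1 \<noteq> T2" "\<not> T1 \<inter> T2 \<subseteq> T3" by blast
    define Z where "Z = span (T1 \<union> T2)"
    note m = min_covers_not_through_common_subspace[OF int T]
    have Z: "subspace Z" "dim Z = t + 2" "T1 \<subseteq> Z"
      using m(1) span_superset[of "T1 \<union> T2"] by (auto simp: Z_def)
    have FZ: "t + 1 \<le> dim (F \<inter> Z)" if "F \<in> \<F>" for F
      using m(2)[OF that] by (simp add: Z_def)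
    have ZW: "subspace (Z \<inter> W)" using Z subspace_W by (auto intro: subspace_inter)
    show ?thesis
    proof (cases "Z \<inter> W = {0}")
      case True
      show ?thesis
        by (rule shadow[of Z]) (use Z FZ family True in auto)
    next
      case False
      have "T1 \<inter> (Z \<inter> W) = {0}"
        using min_coversD[OF T(1)] Z by blast
      \<comment> \<open>\<open>T1\<close> has codimension one in \<open>Z\<close> and meets
        \<open>W\<close> trivially.\<close>
      then have "dim (Z \<inter> W) \<le> 1"
        using dim_Int_ge[of T1 "Z \<inter> W" Z] min_coversD[OF T(1)] Z ZW by simp
      moreover have "dim (Z \<inter> W) \<noteq> 0"
        using dim_trivial_subspace[OF ZW] False by simp
      ultimately have dZW: "dim (Z \<inter> W) = 1" by linarith
      have "real (card \<F>) \<le> real q ^ (t + 1) * real q ^ (l * (n - t - 1))"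
      proof (rule card_le_sum_of_parts)
        \<comment> \<open>Every member contains a \<open>(t + 1)\<close>-subspace of
          \<open>Z\<close>, necessarily a complement in \<open>Z\<close> of the line
          \<open>Z \<inter> W\<close>. There are \<open>q ^ (t + 1)\<close> of these, fewer than all
          hyperplanes of \<open>Z\<close>.\<close>
        let ?Y = "{F. subspace F \<and> {0} \<subseteq> F \<and> F \<subseteq> Z \<and> F \<inter> (Z \<inter> W) = {0}
            \<and> dim F + dim (Z \<inter> W) = dim Z}"
        have "{0} \<inter> (Z \<inter> W) = {0}" "{0} \<subseteq> Z"
          using subspace_0[OF ZW] by auto
        then show "real (card ?Y) \<le> real q ^ (t + 1)"
          using card_complements[of Z "Z \<inter> W" "{0}"] Z ZW dZW by simp
        show "real (card {F \<in> \<F>. Y \<subseteq> F}) \<le> real q ^ (l * (n - t - 1))" if "Y \<in> ?Y" for Y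
          using card_containing_le[of Y] that dZW Z by (simp flip: of_nat_power)
        fix F assume F: "F \<in> \<F>"
        have s: "subspace (F \<inter> Z)" using F Z family_memD by (auto intro: subspace_inter)
        then obtain Y where Y: "subspace Y" "Y \<subseteq> F \<inter> Z" "dim Y = t + 1"
          using choose_subspace_of_subspace[OF FZ[OF F]] by auto
        then have "Y \<inter> W = {0}"
          using Int_W_trivial_subset[of F Y] F family_memD by blast
        then have "Y \<inter> (Z \<inter> W) = {0}" using Y by blast
        then have "Y \<in> ?Y" using Y Z dZW subspace_0 by auto
        then show "\<exists>Y\<in>?Y. Y \<subseteq> F" using Y by blast
      qed auto
      then show ?thesis by (rule shadow_meeting_W)
    qed
  next
    case nex: False
    \<comment> \<open>Two distinct covers supply \<open>X\<close> inside their intersection; a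
      single cover allows any of its \<open>t\<close>-subspaces.\<close>
    have "\<exists>X. subspace X \<and> dim X = t \<and> (\<forall>T\<in>min_covers. X \<subseteq> T)"
    proof (cases "\<exists>T1\<in>min_covers. \<exists>T2\<in>min_covers. T1 \<noteq> T2")
      case True
      then obtain T1 T2 where T: "T1 \<in> min_covers" "T2 \<in> min_covers" "T1 \<noteq> T2" by blast
      have "subspace (T1 \<inter> T2)" using T min_coversD by (auto intro: subspace_inter)
      then obtain X where "subspace X" "X \<subseteq> T1 \<inter> T2" "dim X = t"
        using choose_subspace_of_subspace[OF int[rule_format, OF T(1,2)]] by auto
      then show ?thesis using nex T by blast
    next
      case False
      obtain T where T: "T \<in> min_covers" using \<open>min_covers \<noteq> {}\<close> by auto
      then obtain X where "subspace X" "X \<subseteq> T" "dim X = t"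
        using choose_subspace_of_subspace[of t T] min_coversD[OF T] by auto
      then show ?thesis using False T by blast
    qed
    then obtain X where X: "subspace X" "dim X = t" "\<forall>T\<in>min_covers. X \<subseteq> T" by blast
    obtain T where T: "T \<in> min_covers" using \<open>min_covers \<noteq> {}\<close> by auto
    have XW: "X \<inter> W = {0}"
      using Int_W_trivial_subset[OF min_coversD(2)[OF T] X(1)] X(3) T by simp
    show ?thesis
    proof (cases rule: family_through_common_subspace[OF False X])
      case (1 M)
      show ?thesis
        by (rule hilton_milner[of X M]) (fact X XW 1)+
    next
      case 2
      then have "real (card min_covers) * real q ^ (l * (n - t - 1)) \<le> \<theta> (n - t) * real q ^ (l * (n - t - 1))"
        by (intro mult_right_mono) auto
      then show ?thesis
        using card_le_min_covers[OF False] by (intro few_covers) linarith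
    qed
  qed
qed

end

section \<open>Maximal enlargement and the sizes of the two extremal configurations\<close>

context attenuated_space
begin

lemma exists_maximal_intersecting_family:
  assumes "\<F> \<subseteq> complements" "\<And>A B. A \<in> \<F> \<Longrightarrow> B \<in> \<F> \<Longrightarrow> t \<le> dim (A \<inter> B)" "t \<le> n"
  obtains \<G> where "\<F> \<subseteq> \<G>" "\<G> \<subseteq> complements" "\<And>A B. A \<in> \<G> \<Longrightarrow> B \<in> \<G> \<Longrightarrow> t \<le> dim (A \<inter> B)"
    "\<And>A. A \<in> complements \<Longrightarrow> (\<And>B. B \<in> \<G> \<Longrightarrow> t \<le> dim (A \<inter> B)) \<Longrightarrow> A \<in> \<G>"
proof -
  define S where "S = {\<G>. \<G> \<subseteq> complements \<and> (\<forall>A\<in>\<G>. \<forall>B\<in>\<G>. t \<le> dim (A \<inter> B))}"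
  have "finite S"
    by (rule finite_subset[of _ "Pow complements"]) (auto simp: S_def)
  moreover have "\<F> \<in> S" using assms by (auto simp: S_def)
  ultimately obtain \<G> where \<G>: "\<G> \<in> S" "\<F> \<subseteq> \<G>" "\<forall>\<H>\<in>S. \<G> \<subseteq> \<H> \<longrightarrow> \<G> = \<H>"
    using finite_has_maximal2[of S \<F>] by (elim bexE conjE meta_impE) auto
  have max: "A \<in> \<G>" if A: "A \<in> complements" "\<And>B. B \<in> \<G> \<Longrightarrow> t \<le> dim (A \<inter> B)" for A
  proof -
    \<comment> \<open>Adjoining \<open>A\<close> also adds the pair of \<open>A\<close> with itself,
      which is covered by \<open>t \<le> n\<close>.\<close>
    have "dim (A \<inter> A) = n" using A by (simp add: complements_def)
    then have "insert A \<G> \<in> S"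
      using A \<G>(1) assms(3) by (auto simp: S_def Int_commute[of _ A])
    then have "\<G> = insert A \<G>" using \<G>(3) by auto
    then show ?thesis by auto
  qed
  show ?thesis
  proof (rule that[of \<G>])
    show "A \<in> \<G>" if "A \<in> complements" "\<And>B. B \<in> \<G> \<Longrightarrow> t \<le> dim (A \<inter> B)" for A
      using that by (rule max)
  qed (use \<G>(1,2) in \<open>auto simp: S_def\<close>)
qed

text \<open>The family is the disjoint union of \<open>?A - ?B\<close>, the complements through
  \<open>X\<close> that meet \<open>M\<close> in more than \<open>X\<close>, and
  \<open>?C - ?D\<close>, the complements inside \<open>M\<close> that miss part of
  \<open>X\<close>. The four counts are \<open>q ^ (l * (n - t))\<close>, the product,
  \<open>q ^ n\<close> and \<open>q ^ (n - t)\<close>.\<close>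

lemma card_hilton_milner:
  assumes X: "subspace X" "dim X = t" "X \<inter> W = {0}"
    and M: "subspace M" "dim M = n + 1" "dim (M \<inter> W) = 1" "X \<subseteq> M" and "t < n"
  shows "real (card ({F \<in> complements. X \<subseteq> F \<and> t + 1 \<le> dim (F \<inter> M)} \<union> {F \<in> complements. F \<subseteq> M}))
    = real q ^ (l * (n - t)) - (\<Prod>j = 1..n - t. real q ^ l - real q ^ j)
      + real q ^ (n - t) * (real q ^ t - 1)"
proof -
  let ?A = "{F \<in> complements. X \<subseteq> F}"
  let ?B = "{F. subspace F \<and> X \<subseteq> F \<and> F \<inter> W = {0} \<and> dim F = n \<and> F \<inter> M = X}"
  let ?C = "{F \<in> complements. F \<subseteq> M}"
  let ?D = "{F \<in> complements. X \<subseteq> F \<and> F \<subseteq> M}"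
  have "dim (M \<union> W) = dim UNIV"
    using dim_Un_Int[of M W] M subspace_W by (simp add: dim_W dim_V)
  then have MW: "span (M \<union> W) = UNIV"
    using subspace_dim_equal[of "span (M \<union> W)" UNIV] by simp
  have dimFM: "t + 1 \<le> dim (F \<inter> M) \<longleftrightarrow> F \<inter> M \<noteq> X" if "F \<in> complements" "X \<subseteq> F" for F
  proof -
    have s: "subspace (F \<inter> M)" "X \<subseteq> F \<inter> M"
      using that M by (auto simp: complements_def intro: subspace_inter)
    then have "t \<le> dim (F \<inter> M)" using dim_subset[of X "F \<inter> M"] X by simp
    moreover have "F \<inter> M = X" if "dim (F \<inter> M) = t"
      using subspace_dim_equal[OF X(1) s] that X(2) by simp
    moreover have "dim (F \<inter> M) = t" if "F \<inter> M = X"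
      by (simp only: that X(2))
    ultimately show ?thesis by linarith
  qed
  have eq: "{F \<in> complements. X \<subseteq> F \<and> t + 1 \<le> dim (F \<inter> M)} \<union> ?C = (?A - ?B) \<union> (?C - ?D)"
  proof -
    have "{F \<in> complements. X \<subseteq> F \<and> t + 1 \<le> dim (F \<inter> M)}
        = {F \<in> complements. X \<subseteq> F \<and> F \<inter> M \<noteq> X}"
    proof (rule Collect_cong)
      fix F show "F \<in> complements \<and> X \<subseteq> F \<and> t + 1 \<le> dim (F \<inter> M)
          \<longleftrightarrow> F \<in> complements \<and> X \<subseteq> F \<and> F \<inter> M \<noteq> X"
        using dimFM[of F] by blast
    qed
    also have "\<dots> = ?A - ?B"
      by (auto simp: complements_def)
    finally have AB: "{F \<in> complements. X \<subseteq> F \<and> t + 1 \<le> dim (F \<inter> M)} = ?A - ?B" .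
    \<comment> \<open>For \<open>F \<subseteq> M\<close> the intersection with \<open>M\<close> has
      dimension \<open>n\<close>, which is at least \<open>t + 1\<close>.\<close>
    have D: "?D \<subseteq> {F \<in> complements. X \<subseteq> F \<and> t + 1 \<le> dim (F \<inter> M)}"
      using \<open>t < n\<close> by (auto simp: complements_def Int_absorb2)
    have "S \<union> C = S \<union> (C - D)" if "D \<subseteq> S" for S C D :: "'b set set"
      using that by blast
    from this[OF D, of ?C] show ?thesis unfolding AB .
  qed
  have dim0: "F \<inter> (M \<inter> W) = {0} \<longleftrightarrow> F \<inter> W = {0}" if "F \<subseteq> M" for F
  proof -
    have "F \<inter> (M \<inter> W) = F \<inter> W" using that by auto
    then show ?thesis by simp
  qed
  have "?C = {F. subspace F \<and> {0} \<subseteq> F \<and> F \<subseteq> M \<and> F \<inter> (M \<inter> W) = {0} \<and> dim F + dim (M \<inter> W) = dim M}"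
  proof (rule Collect_cong)
    fix F show "F \<in> complements \<and> F \<subseteq> M \<longleftrightarrow> subspace F \<and> {0} \<subseteq> F \<and> F \<subseteq> M
        \<and> F \<inter> (M \<inter> W) = {0} \<and> dim F + dim (M \<inter> W) = dim M"
      using M(2,3) dim0[of F] subspace_0[of F] by (auto simp: complements_def)
  qed
  then have cC: "card ?C = q ^ n"
    using card_complements[of M "M \<inter> W" "{0}"] M subspace_W
    by (simp add: subspace_inter subspace_0)
  have "?D = {F. subspace F \<and> X \<subseteq> F \<and> F \<subseteq> M \<and> F \<inter> (M \<inter> W) = {0} \<and> dim F + dim (M \<inter> W) = dim M}"
    using M dim0 by (auto simp: complements_def)
  then have cD: "card ?D = q ^ (n - t)"
    using card_complements[of M "M \<inter> W" X] M subspace_W X dim0[of X]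
    by (simp add: subspace_inter)
  have cA: "card ?A = q ^ (l * (n - t))"
    using card_complements_containing[OF X(1,3)] X(2) by simp
  have "X \<inter> M = X" using M by auto
  then have "real (card ?B) = (\<Prod>k\<in>{t..<n}. real q ^ l - real q ^ (k - t + 1))"
    using card_complements_avoiding[OF subspace_W M(1) X(1) M(4) MW X(1,3), of n] \<open>t < n\<close> X M
    by (simp add: dim_W dim_V)
  \<comment> \<open>The shift by one in \<open>j = k - t + 1\<close> is the dimension of
    \<open>M \<inter> W\<close>.\<close>
  also have "\<dots> = (\<Prod>j = 1..n - t. real q ^ l - real q ^ j)"
    by (rule prod.reindex_bij_witness[of _ "\<lambda>j. j + t - 1" "\<lambda>k. k - t + 1"]) (use \<open>t < n\<close> in auto)
  finally have cB: "real (card ?B) = (\<Prod>j = 1..n - t. real q ^ l - real q ^ j)" .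
  have BA: "?B \<subseteq> ?A" by (auto simp: complements_def)
  have DC: "?D \<subseteq> ?C" by auto
  have "card ((?A - ?B) \<union> (?C - ?D)) = card (?A - ?B) + card (?C - ?D)"
    by (rule card_Un_disjoint) auto
  moreover have "real (card (?A - ?B)) = real (card ?A) - real (card ?B)"
    using card_Diff_subset[OF _ BA] card_mono[OF _ BA] by (simp add: of_nat_diff)
  moreover have "real (card (?C - ?D)) = real (card ?C) - real (card ?D)"
    using card_Diff_subset[OF _ DC] card_mono[OF _ DC] by (simp add: of_nat_diff)
  moreover have "real q ^ n = real q ^ (n - t) * real q ^ t"
    using \<open>t < n\<close> by (simp flip: power_add)
  ultimately show ?thesis
    unfolding eq using cA cB cC cD by (simp add: algebra_simps)
qed

text \<open>A member either contains \<open>Z\<close> or meets it exactly in a hyperplane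
  \<open>Y\<close>. Members of the second kind are the complements through \<open>Y\<close> minus
  those through \<open>Z\<close>; summing over the \<open>\<theta> (t + 2)\<close> hyperplanes and
  using \<open>theta_Suc\<close> gives the stated form.\<close>

lemma card_shadow:
  assumes Z: "subspace Z" "dim Z = t + 2" "Z \<inter> W = {0}"
  shows "real (card {F \<in> complements. t + 1 \<le> dim (F \<inter> Z)})
    = real q ^ (l * (n - t - 1)) * \<theta> (t + 2) - real q ^ (l * (n - t - 2) + 1) * \<theta> (t + 1)"
proof -
  let ?Y = "{H. subspace H \<and> H \<subseteq> Z \<and> dim H + 1 = dim Z}"
  let ?S = "\<lambda>Y. {F \<in> complements. F \<inter> Z = Y}"
  have "{F \<in> complements. t + 1 \<le> dim (F \<inter> Z)} = {F \<in> complements. Z \<subseteq> F} \<union> (\<Union>Y\<in>?Y. ?S Y)"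
  proof -
    have "Z \<subseteq> F \<or> F \<inter> Z \<in> ?Y" if "F \<in> complements" "t + 1 \<le> dim (F \<inter> Z)" for F
    proof (cases "dim (F \<inter> Z) = t + 2")
      case True
      then have "F \<inter> Z = Z"
        using subspace_dim_equal[of "F \<inter> Z" Z] Z that by (auto simp: complements_def subspace_inter)
      then show ?thesis by blast
    next
      case False
      moreover have "dim (F \<inter> Z) \<le> t + 2" using Z dim_subset[of "F \<inter> Z" Z] by simp
      ultimately show ?thesis
        using that Z by (auto simp: complements_def subspace_inter)
    qed
    moreover have "F \<inter> Z = Z" if "Z \<subseteq> F" for F using that by blast
    ultimately show ?thesis using Z by auto
  qed
  moreover have "card ({F \<in> complements. Z \<subseteq> F} \<union> (\<Union>Y\<in>?Y. ?S Y))
      = card {F \<in> complements. Z \<subseteq> F} + card (\<Union>Y\<in>?Y. ?S Y)"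
  proof (rule card_Un_disjoint)
    have "F \<inter> Z = Z" if "Z \<subseteq> F" for F using that by blast
    then show "{F \<in> complements. Z \<subseteq> F} \<inter> (\<Union>Y\<in>?Y. ?S Y) = {}" by auto
  qed auto
  moreover have "card (\<Union>Y\<in>?Y. ?S Y) = (\<Sum>Y\<in>?Y. card (?S Y))"
    by (rule card_UN_disjoint) auto
  moreover have "real (card (?S Y)) = real q ^ (l * (n - t - 1)) - real q ^ (l * (n - t - 2))"
    if Y: "Y \<in> ?Y" for Y
  proof -
    have "?S Y = {F \<in> complements. Y \<subseteq> F} - {F \<in> complements. Z \<subseteq> F}"
    proof -
      have "F \<inter> Z = Y" if F: "F \<in> complements" "Y \<subseteq> F" "\<not> Z \<subseteq> F" for F
      proof -
        have s: "subspace (F \<inter> Z)" using F Z by (auto simp: complements_def subspace_inter)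
        have "dim (F \<inter> Z) \<noteq> dim Z"
          using subspace_dim_equal[of "F \<inter> Z" Z] s Z F by auto
        moreover have "dim (F \<inter> Z) \<le> dim Z" using dim_subset[of "F \<inter> Z" Z] by simp
        ultimately show ?thesis
          using subspace_dim_equal[of Y "F \<inter> Z"] s F Y by auto
      qed
      moreover have "\<not> Z \<subseteq> F" if "F \<inter> Z = Y" for F
      proof
        assume "Z \<subseteq> F"
        then have "Y = Z" using that by blast
        then show False using Y by auto
      qed
      ultimately show ?thesis by auto
    qed
    moreover have "{F \<in> complements. Z \<subseteq> F} \<subseteq> {F \<in> complements. Y \<subseteq> F}"
      using Y by auto
    ultimately have "real (card (?S Y))
        = real (card {F \<in> complements. Y \<subseteq> F}) - real (card {F \<in> complements. Z \<subseteq> F})"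
      using card_Diff_subset card_mono by (simp add: of_nat_diff card_Diff_subset card_mono)
    then show ?thesis
      using card_complements_containing[of Z] card_complements_containing[of Y] Y Z
        Int_W_trivial_subset[of Z Y] by simp
  qed
  ultimately have "real (card {F \<in> complements. t + 1 \<le> dim (F \<inter> Z)}) = real q ^ (l * (n - t - 2))
      + real (card ?Y) * (real q ^ (l * (n - t - 1)) - real q ^ (l * (n - t - 2)))"
    using card_complements_containing[of Z] Z by simp
  also have "real (card ?Y) = \<theta> (t + 2)"
    using card_hyperplanes[of Z] Z by simp
  finally show ?thesis
    using theta_Suc[of "t + 1"] by (simp add: algebra_simps)
qed

end

section \<open>Comparison of the bounds\<close>

text \<open>First and second order truncations of the expanded product, with the square of the sum
  as a crude second order term. The upper bound 1 is carried through the same induction because the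
  lower estimate uses it.\<close>

lemma prod_one_minus_bounds:
  fixes y :: "nat \<Rightarrow> real"
  assumes "\<And>j. j \<in> A \<Longrightarrow> 0 \<le> y j \<and> y j \<le> 1" "finite A"
  shows "1 - sum y A \<le> (\<Prod>j\<in>A. 1 - y j)"
    and "(\<Prod>j\<in>A. 1 - y j) \<le> 1 - sum y A + (sum y A)\<^sup>2"
proof -
  have "1 - sum y A \<le> (\<Prod>j\<in>A. 1 - y j) \<and> (\<Prod>j\<in>A. 1 - y j) \<le> 1 - sum y A + (sum y A)\<^sup>2
      \<and> (\<Prod>j\<in>A. 1 - y j) \<le> 1"
    using assms(2,1)
  proof (induction A rule: finite_induct)
    case (insert k A)
    let ?s = "sum y A" and ?p = "\<Prod>j\<in>A. 1 - y j"
    have IH: "1 - ?s \<le> ?p" "?p \<le> 1 - ?s + ?s\<^sup>2" "?p \<le> 1"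
      using insert by auto
    have k: "0 \<le> y k" "y k \<le> 1" and s: "0 \<le> ?s" and p: "0 \<le> ?p"
      using insert.prems by (auto intro!: sum_nonneg prod_nonneg)
    have "(1 - y k) * ?p \<le> (1 - y k) * (1 - ?s + ?s\<^sup>2)"
      using IH k by (intro mult_left_mono) auto
    also have "\<dots> \<le> 1 - (y k + ?s) + (y k + ?s)\<^sup>2"
      using k s by (simp add: power2_eq_square algebra_simps)
    finally have 1: "(1 - y k) * ?p \<le> 1 - (y k + ?s) + (y k + ?s)\<^sup>2" .
    have "y k * ?p \<le> y k"
      using k IH p by (intro mult_left_le) auto
    then have 2: "1 - (y k + ?s) \<le> (1 - y k) * ?p"
      using IH by (simp add: algebra_simps)
    have 3: "(1 - y k) * ?p \<le> 1"
      using k IH p by (intro mult_le_one) auto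
    show ?case
      using 1 2 3 insert.hyps by simp
  qed simp
  then show "1 - sum y A \<le> (\<Prod>j\<in>A. 1 - y j)"
    "(\<Prod>j\<in>A. 1 - y j) \<le> 1 - sum y A + (sum y A)\<^sup>2" by auto
qed

section \<open>Inequalities between powers of \<open>q\<close> and the numbers
  \<open>\<theta> m\<close>\<close>

context finite_field_vector_space
begin

lemma theta_mult_le: "\<theta> m * (real q - 1) \<le> real q ^ m"
  by (simp add: theta_mult)

lemma theta_le: "\<theta> m \<le> real q ^ m"
proof -
  have "\<theta> m * 1 \<le> \<theta> m * (real q - 1)"
    using q_ge_2 theta_nonneg by (intro mult_left_mono) auto
  then show ?thesis
    using theta_mult_le[of m] by simp
qed

lemma theta_1 [simp]: "\<theta> (Suc 0) = 1"
  using theta_Suc[of 0] by simp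

lemma theta_ge_1: "1 \<le> m \<Longrightarrow> 1 \<le> \<theta> m"
  using theta_mono[of 1 m] by simp

lemma theta_Suc_le: "1 \<le> m \<Longrightarrow> \<theta> (Suc m) \<le> (real q + 1) * \<theta> m"
  using theta_Suc[of m] theta_ge_1[of m] by (simp add: algebra_simps)

lemma power_le_theta_Suc: "real q ^ m \<le> \<theta> (Suc m)"
  using theta_Suc'[of m] theta_nonneg[of m] by simp

text \<open>Bounds every factor \<open>\<theta> (t + j) / \<theta> j\<close> of a Gaussian
  coefficient by \<open>\<theta> (t + 1)\<close>, uniformly in \<open>j\<close>. The induction on
  \<open>t\<close> rests on \<open>q ^ j \<le> q * \<theta> j\<close>.\<close>

lemma theta_add_le:
  assumes "1 \<le> j"
  shows "\<theta> (t + j) \<le> \<theta> j * \<theta> (t + 1)"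
proof (induction t)
  case (Suc t)
  have "\<theta> (Suc t + j) = \<theta> (t + j) + real q ^ t * real q ^ j"
    using theta_Suc'[of "t + j"] by (simp add: power_add)
  also have "real q ^ t * real q ^ j \<le> real q ^ t * (real q * \<theta> j)"
  proof (rule mult_left_mono)
    obtain k where "j = Suc k" using assms by (cases j) auto
    then show "real q ^ j \<le> real q * \<theta> j"
      using power_le_theta_Suc[of k] by (simp add: mult_left_mono)
  qed simp
  also have "\<theta> (t + j) + real q ^ t * (real q * \<theta> j) \<le> \<theta> j * \<theta> (t + 1) + \<theta> j * real q ^ (t + 1)"
    using Suc by simp
  also have "\<dots> = \<theta> j * \<theta> (Suc t + 1)"
    using theta_Suc'[of "t + 1"] by (simp add: algebra_simps)
  finally show ?case by simp
qed simp

section \<open>Comparing the extremal sizes with each other and with the remaining bounds\<close>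

context
  fixes n l t :: nat
  assumes t_pos: "1 \<le> t" and t_le: "t + 2 \<le> n" and l_ge: "n + t + 2 \<le> l"
    and l_ge_binary: "q = 2 \<longrightarrow> n + t + 4 \<le> l"
begin

private abbreviation (input) "Q \<equiv> real q"
private abbreviation (input) "a \<equiv> n - t"
text \<open>\<open>N\<close> and \<open>N2\<close> are the numbers of complements through a given
  \<open>(t + 1)\<close>-space and \<open>(t + 2)\<close>-space that meet \<open>W\<close>
  trivially.\<close>

private abbreviation (input) "N \<equiv> real q ^ (l * (n - t - 1))"
private abbreviation (input) "N2 \<equiv> real q ^ (l * (n - t - 2))"

lemma Q_ge_2: "2 \<le> Q"
  using q_ge_2 by simp

lemma N2_ge_1: "1 \<le> N2"
  using Q_ge_2 by (intro one_le_power) simp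

lemma N_eq: "N = Q ^ l * N2"
proof -
  have "n - t - 1 = Suc (n - t - 2)" using t_le by simp
  then show ?thesis by (simp add: power_add)
qed

text \<open>Excluding the two pairs \<open>(l, q)\<close> provides the surplus factor that \<open>q = 2\<close> needs.\<close>

lemma q_power_l_cases:
  obtains "q = 2" "Q ^ (a + 2 * t + 4) \<le> Q ^ l" | "3 \<le> Q" "Q ^ (a + 2 * t + 2) \<le> Q ^ l"
proof (cases "q = 2")
  case True
  have "Q ^ (a + 2 * t + 4) \<le> Q ^ l"
    by (rule power_increasing) (use True l_ge_binary t_le in auto)
  then show ?thesis
    by (rule that(1)[OF True])
next
  case False
  then have "3 \<le> q" using q_ge_2 by simp
  have "Q ^ (a + 2 * t + 2) \<le> Q ^ l"
    by (rule power_increasing) (use \<open>3 \<le> q\<close> l_ge t_le in auto)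
  then show ?thesis
    using \<open>3 \<le> q\<close> by (intro that(2)) simp_all
qed

text \<open>In its own range of \<open>t\<close>, each extremal size is about \<open>q \<theta>\<^bsub>n-t\<^esub> q\<^bsup>l(n-t-1)\<^esup>\<close> or larger; \<open>15/16\<close> of this
  number separates it from the cases that are not extremal.\<close>

lemma few_covers_bound:
  "\<theta> a * N + \<theta> (t + 1) * (\<theta> (a + 1) * (\<theta> (a + 1) * N2)) < 15 / 16 * (Q * \<theta> a * N)"
proof -
  have a1: "1 \<le> a" using t_le by simp
  have pos: "0 < (Q - 1)\<^sup>2" using Q_ge_2 by simp
  have th: "0 < \<theta> a" using theta_pos a1 by simp
  \<comment> \<open>Factors \<open>Q - 1\<close> turn two of the three thetas into plain powers; the
    third is reduced to \<open>\<theta> a\<close>, which cancels against the right-hand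
    side.\<close>
  have "(\<theta> (t + 1) * (Q - 1)) * (\<theta> (a + 1) * (Q - 1)) * \<theta> (a + 1)
      \<le> (Q ^ (t + 1) * Q ^ (a + 1)) * ((Q + 1) * \<theta> a)"
    using theta_Suc_le[OF a1] Q_ge_2
    by (intro mult_mono theta_mult_le mult_nonneg_nonneg theta_nonneg) simp_all
  then have 1: "(\<theta> (t + 1) * \<theta> (a + 1) * \<theta> (a + 1)) * (Q - 1)\<^sup>2 \<le> (Q ^ (a + t + 2) * (Q + 1)) * \<theta> a"
    by (simp add: power2_eq_square power_add algebra_simps)
  have "Q ^ (a + t + 2) * (Q + 1) < Q ^ l * (15 / 16 * Q - 1) * (Q - 1)\<^sup>2"
  proof (cases rule: q_power_l_cases)
    case 1
    \<comment> \<open>For \<open>q = 2\<close> the claim has the factor 3 on the left and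
      \<open>7 / 8\<close> on the right, so a surplus of three binary powers suffices.\<close>
    have "Q ^ (a + t + 2) * 8 = Q ^ (a + t + 5)"
      using 1(1) by (simp add: power_add)
    also have "\<dots> \<le> Q ^ (a + 2 * t + 4)"
      using Q_ge_2 t_pos by (intro power_increasing) auto
    finally have "Q ^ (a + t + 2) * 8 \<le> Q ^ l" using 1(2) by linarith
    moreover have "0 < Q ^ (a + t + 2)" using Q_ge_2 by simp
    ultimately have "Q ^ (a + t + 2) * 3 < Q ^ l * (7 / 8)" by linarith
    moreover have "Q + 1 = 3" "(15 / 16 * Q - 1) * (Q - 1)\<^sup>2 = 7 / 8"
      using 1(1) by simp_all
    ultimately show ?thesis by (simp only: mult.assoc)
  next
    case 2
    have "Q ^ (a + t + 2) * (Q + 1) < Q ^ (a + t + 2) * (Q * 4)"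
      using 2 by (intro mult_strict_left_mono) auto
    also have "\<dots> = Q ^ (a + t + 3) * (1 * 4)"
      by (simp add: power_add eval_nat_numeral)
    also have "\<dots> \<le> Q ^ l * ((15 / 16 * Q - 1) * (Q - 1)\<^sup>2)"
    proof (intro mult_mono)
      have "Q ^ (a + t + 3) \<le> Q ^ (a + 2 * t + 2)"
        using Q_ge_2 t_pos by (intro power_increasing) auto
      then show "Q ^ (a + t + 3) \<le> Q ^ l" using 2(2) by linarith
      show "4 \<le> (Q - 1)\<^sup>2"
        using power_mono[of 2 "Q - 1" 2] 2 by simp
    qed (use 2 in auto)
    finally show ?thesis by (simp add: mult.assoc)
  qed
  then have "(Q ^ (a + t + 2) * (Q + 1)) * \<theta> a < Q ^ l * (15 / 16 * Q - 1) * (Q - 1)\<^sup>2 * \<theta> a"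
    using th by (intro mult_strict_right_mono)
  from le_less_trans[OF 1 this] have "(\<theta> (t + 1) * \<theta> (a + 1) * \<theta> (a + 1)) * (Q - 1)\<^sup>2
      < (Q ^ l * (15 / 16 * Q - 1) * \<theta> a) * (Q - 1)\<^sup>2"
    by (simp only: mult_ac)
  then have "\<theta> (t + 1) * \<theta> (a + 1) * \<theta> (a + 1) < Q ^ l * (15 / 16 * Q - 1) * \<theta> a"
    using pos by (simp only: mult_less_cancel_right_pos)
  then have "(\<theta> (t + 1) * \<theta> (a + 1) * \<theta> (a + 1)) * N2 < (Q ^ l * (15 / 16 * Q - 1) * \<theta> a) * N2"
    by (rule mult_strict_right_mono) (use N2_ge_1 in linarith)
  then show ?thesis
    unfolding N_eq by (simp add: algebra_simps)
qed

text \<open>Raising \<open>i\<close> by one multiplies the bound by at most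
  \<open>Q ^ (t + 1) * Q ^ (a + 1) / Q ^ l\<close>, and this is at most 1 since
  \<open>n + 2 \<le> l\<close>. The case \<open>i = 2\<close> is therefore the worst.\<close>

lemma large_covers_bound:
  assumes "2 \<le> i" "i \<le> a"
  shows "(\<Prod>j=1..i. \<theta> (t + j) / \<theta> j) * (\<theta> (a + 1) ^ i * Q ^ (l * (n - t - i)))
    < 15 / 16 * (Q * \<theta> a * N)"
proof -
  have a1: "1 \<le> a" using t_le by simp
  have th: "0 < \<theta> a" using theta_pos a1 by simp
  have "(\<Prod>j=1..i. \<theta> (t + j) / \<theta> j) * (\<theta> (a + 1) ^ i * Q ^ (l * (n - t - i)))
      \<le> (\<Prod>j=1..2. \<theta> (t + j) / \<theta> j) * (\<theta> (a + 1) ^ 2 * N2)"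
    using assms
  proof (induction i rule: dec_induct)
    case (step i)
    let ?p = "\<Prod>j=1..i. \<theta> (t + j) / \<theta> j"
    have "\<theta> (t + Suc i) / \<theta> (Suc i) \<le> \<theta> (t + 1)"
      using theta_add_le[of "Suc i" t] theta_pos[of "Suc i"] by (simp add: divide_le_eq mult.commute)
    then have "\<theta> (t + Suc i) / \<theta> (Suc i) * \<theta> (a + 1) \<le> Q ^ (t + 1) * Q ^ (a + 1)"
      using Q_ge_2 order_trans[OF _ theta_le[of "t + 1"]]
      by (intro mult_mono theta_le theta_nonneg) simp_all
    also have "\<dots> \<le> Q ^ l"
      unfolding power_add[symmetric] using Q_ge_2 t_le l_ge by (intro power_increasing) auto
    finally have *: "\<theta> (t + Suc i) / \<theta> (Suc i) * \<theta> (a + 1) \<le> Q ^ l" .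
    have p: "0 \<le> ?p" using theta_nonneg by (intro prod_nonneg) auto
    have "n - t - i = Suc (n - t - Suc i)" using step.prems by simp
    then have l: "Q ^ (l * (n - t - i)) = Q ^ l * Q ^ (l * (n - t - Suc i))"
      by (simp add: power_add)
    have "(\<Prod>j=1..Suc i. \<theta> (t + j) / \<theta> j) * (\<theta> (a + 1) ^ Suc i * Q ^ (l * (n - t - Suc i)))
        = (\<theta> (t + Suc i) / \<theta> (Suc i) * \<theta> (a + 1))
          * (?p * \<theta> (a + 1) ^ i * Q ^ (l * (n - t - Suc i)))"
      by (simp add: mult_ac)
    also have "\<dots> \<le> Q ^ l * (?p * \<theta> (a + 1) ^ i * Q ^ (l * (n - t - Suc i)))"
      using * p theta_nonneg Q_ge_2 by (intro mult_right_mono) auto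
    also have "\<dots> = ?p * (\<theta> (a + 1) ^ i * Q ^ (l * (n - t - i)))"
      unfolding l by (simp add: mult_ac)
    also have "\<dots> \<le> (\<Prod>j=1..2. \<theta> (t + j) / \<theta> j) * (\<theta> (a + 1) ^ 2 * N2)"
      using step by simp
    finally show ?case .
  qed simp
  also have "(\<Prod>j=1..2. \<theta> (t + j) / \<theta> j) * (\<theta> (a + 1) ^ 2 * N2)
      = \<theta> (t + 1) * \<theta> (t + 2) * \<theta> (a + 1) * \<theta> (a + 1) / (Q + 1) * N2"
    using theta_Suc[of 1] by (simp add: numeral_2_eq_2 power2_eq_square add.commute)
  also have "\<dots> < 15 / 16 * Q * \<theta> a * Q ^ l * N2"
  proof (rule mult_strict_right_mono)
    \<comment> \<open>Three of the four thetas become powers. The last one yields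
      \<open>(Q + 1) * \<theta> a\<close>, whose \<open>Q + 1\<close> is matched by the denominator
      \<open>\<theta> 2\<close>.\<close>
    have "(\<theta> (t + 1) * (Q - 1)) * (\<theta> (t + 2) * (Q - 1)) * (\<theta> (a + 1) * (Q - 1)) * \<theta> (a + 1)
        \<le> Q ^ (t + 1) * Q ^ (t + 2) * Q ^ (a + 1) * ((Q + 1) * \<theta> a)"
      using theta_Suc_le[OF a1] Q_ge_2
      by (intro mult_mono theta_mult_le mult_nonneg_nonneg theta_nonneg) simp_all
    then have 1: "(\<theta> (t + 1) * \<theta> (t + 2) * \<theta> (a + 1) * \<theta> (a + 1)) * (Q - 1) ^ 3
        \<le> (Q ^ (a + 2 * t + 4) * \<theta> a) * (Q + 1)"
      by (simp add: power_add mult_ac power3_eq_cube power2_eq_square mult_2 eval_nat_numeral)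
    have "Q ^ (a + 2 * t + 4) < 15 / 16 * Q * Q ^ l * (Q - 1) ^ 3"
    proof (cases rule: q_power_l_cases)
      case 1
      \<comment> \<open>For \<open>q = 2\<close> the exponent \<open>a + 2 * t + 4\<close> is
        exactly the guaranteed lower bound on \<open>l\<close>, and the factor \<open>15 / 8\<close>
        gives strictness.\<close>
      have "0 < Q ^ l" using Q_ge_2 by simp
      then have "Q ^ l < 15 / 16 * Q * Q ^ l * (Q - 1) ^ 3"
        using 1(1) by simp
      then show ?thesis using 1 by linarith
    next
      case 2
      \<comment> \<open>For \<open>Q \<ge> 3\<close> the bound on \<open>l\<close> is two powers of
        \<open>Q\<close> short; \<open>(Q - 1) ^ 3\<close> makes up for them.\<close>
      have "Q ^ (a + 2 * t + 4) = Q ^ (a + 2 * t + 2) * (Q * Q)"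
        by (simp add: power_add eval_nat_numeral)
      also have "\<dots> \<le> Q ^ l * (Q * Q)"
        using 2 by (intro mult_right_mono) auto
      also have "\<dots> < Q ^ l * (15 / 16 * Q * (Q - 1) ^ 3)"
      proof (intro mult_strict_left_mono)
        have "4 * (Q - 1) \<le> (Q - 1)\<^sup>2 * (Q - 1)"
          using power_mono[of 2 "Q - 1" 2] 2 by (intro mult_right_mono) auto
        then have "Q < 15 / 16 * (Q - 1) ^ 3"
          using 2 by (simp add: power3_eq_cube power2_eq_square)
        then have "Q * Q < Q * (15 / 16 * (Q - 1) ^ 3)"
          using 2 by (intro mult_strict_left_mono) auto
        then show "Q * Q < 15 / 16 * Q * (Q - 1) ^ 3"
          by (simp add: mult_ac)
      qed (use 2 in auto)
      finally show ?thesis by (simp add: mult_ac)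
    qed
    then have "(Q ^ (a + 2 * t + 4) * \<theta> a) * (Q + 1)
        < (15 / 16 * Q * Q ^ l * (Q - 1) ^ 3 * \<theta> a) * (Q + 1)"
      using th Q_ge_2 by (intro mult_strict_right_mono) auto
    from le_less_trans[OF 1 this]
    have "(\<theta> (t + 1) * \<theta> (t + 2) * \<theta> (a + 1) * \<theta> (a + 1)) * (Q - 1) ^ 3
        < (15 / 16 * Q * \<theta> a * Q ^ l * (Q + 1)) * (Q - 1) ^ 3"
      by (simp only: mult_ac)
    then have "\<theta> (t + 1) * \<theta> (t + 2) * \<theta> (a + 1) * \<theta> (a + 1) < 15 / 16 * Q * \<theta> a * Q ^ l * (Q + 1)"
      using Q_ge_2 by (subst (asm) mult_less_cancel_right_pos) auto
    then show "\<theta> (t + 1) * \<theta> (t + 2) * \<theta> (a + 1) * \<theta> (a + 1) / (Q + 1) < 15 / 16 * Q * \<theta> a * Q ^ l"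
      using Q_ge_2 by (simp add: divide_less_eq)
  qed (use N2_ge_1 in linarith)
  finally show ?thesis
    unfolding N_eq by (simp add: mult_ac)
qed

private abbreviation (input) "hilton_milner_size \<equiv>
  Q ^ (l * (n - t)) - (\<Prod>j = 1..n - t. Q ^ l - Q ^ j) + Q ^ (n - t) * (Q ^ t - 1)"

private abbreviation (input) "shadow_size \<equiv> N * \<theta> (t + 2) - Q ^ (l * (n - t - 2) + 1) * \<theta> (t + 1)"

text \<open>The source of the constant \<open>15 / 16\<close>: both the relative second order error
  in the Hilton-Milner size and the ratio \<open>N2 / N\<close> become at most
  \<open>1 / 16\<close>.\<close>

lemma q_theta_le_power_l: "16 * (Q * \<theta> a) \<le> Q ^ l"
proof (cases rule: q_power_l_cases)
  case 1
  have "16 * (Q * \<theta> a) \<le> 16 * (Q * Q ^ a)"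
    using theta_le Q_ge_2 by (intro mult_left_mono) auto
  also have "\<dots> = Q ^ (a + 5)"
    using 1(1) by (simp add: power_add)
  also have "\<dots> \<le> Q ^ (a + 2 * t + 4)"
    using Q_ge_2 t_pos by (intro power_increasing) auto
  finally show ?thesis using 1(2) by linarith
next
  case 2
  have "16 * (Q * \<theta> a) \<le> 27 * (Q * Q ^ a)"
    using theta_le theta_nonneg Q_ge_2 by (intro mult_mono) auto
  also have "\<dots> \<le> Q ^ 3 * (Q * Q ^ a)"
    using power_mono[of 3 Q 3] 2 by (intro mult_right_mono) auto
  also have "\<dots> = Q ^ (a + 4)"
    by (simp add: power_add eval_nat_numeral)
  also have "\<dots> \<le> Q ^ (a + 2 * t + 2)"
    using Q_ge_2 t_pos by (intro power_increasing) auto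
  finally show ?thesis using 2(2) by linarith
qed

lemma sum_q_powers: "(\<Sum>j=1..m. Q ^ j) = Q * \<theta> m"
  by (induction m) (simp_all add: theta_Suc' algebra_simps)

text \<open>With \<open>Q ^ (l * a)\<close> taken out, the factors are
  \<open>1 - Q ^ j / Q ^ l\<close>, and the subtracted terms sum to
  \<open>Q * \<theta> a / Q ^ l\<close>; the truncated expansions apply. The third equation
  identifies the first order term.\<close>

lemma hilton_milner_product:
  "Q ^ (l * a) * (1 - (Q * \<theta> a / Q ^ l)) \<le> (\<Prod>j = 1..a. Q ^ l - Q ^ j)"
  "(\<Prod>j = 1..a. Q ^ l - Q ^ j) \<le> Q ^ (l * a) * (1 - Q * \<theta> a / Q ^ l + (Q * \<theta> a / Q ^ l)\<^sup>2)"
  "Q ^ (l * a) * (Q * \<theta> a / Q ^ l) = Q * \<theta> a * N"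
proof -
  have x: "0 < Q ^ l" using Q_ge_2 by simp
  have "(\<Prod>j = 1..a. Q ^ l - Q ^ j) = (\<Prod>j = 1..a. Q ^ l * (1 - Q ^ j / Q ^ l))"
    using x by (intro prod.cong) (auto simp: field_simps)
  also have "\<dots> = Q ^ (l * a) * (\<Prod>j = 1..a. 1 - Q ^ j / Q ^ l)"
    by (simp add: prod.distrib power_mult)
  finally have eq: "(\<Prod>j = 1..a. Q ^ l - Q ^ j) = Q ^ (l * a) * (\<Prod>j = 1..a. 1 - Q ^ j / Q ^ l)" .
  have s: "(\<Sum>j=1..a. Q ^ j / Q ^ l) = Q * \<theta> a / Q ^ l"
    using sum_q_powers[of a] by (simp flip: sum_divide_distrib)
  have b: "0 \<le> Q ^ j / Q ^ l \<and> Q ^ j / Q ^ l \<le> 1" if "j \<in> {1..a}" for j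
    using that x Q_ge_2 t_le l_ge by (auto simp: divide_le_eq intro!: power_increasing)
  note p = prod_one_minus_bounds[where A = "{1..a}" and y = "\<lambda>j. Q ^ j / Q ^ l", unfolded s, OF b]
  show "Q ^ (l * a) * (1 - (Q * \<theta> a / Q ^ l)) \<le> (\<Prod>j = 1..a. Q ^ l - Q ^ j)"
    unfolding eq by (intro mult_left_mono p(1)) simp_all
  show "(\<Prod>j = 1..a. Q ^ l - Q ^ j) \<le> Q ^ (l * a) * (1 - Q * \<theta> a / Q ^ l + (Q * \<theta> a / Q ^ l)\<^sup>2)"
    unfolding eq by (intro mult_left_mono p(2)) simp_all
  have "a = Suc (n - t - 1)" using t_le by simp
  then have "Q ^ (l * a) = Q ^ l * N"
    by (metis mult_Suc_right power_add)
  then show "Q ^ (l * a) * (Q * \<theta> a / Q ^ l) = Q * \<theta> a * N"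
    using x by simp
qed

text \<open>Writing \<open>s\<close> for the first order sum, the second order bound leaves
  \<open>s * (1 - s)\<close>, where \<open>s \<le> 1 / 16\<close>. The members inside
  \<open>M\<close> that do not contain \<open>X\<close> are discarded.\<close>

lemma hilton_milner_size_ge: "15 / 16 * (Q * \<theta> a * N) \<le> hilton_milner_size"
proof -
  let ?s = "Q * \<theta> a / Q ^ l"
  have x: "0 < Q ^ l" using Q_ge_2 by simp
  have s: "0 \<le> ?s" "?s \<le> 1 / 16"
    using q_theta_le_power_l x theta_nonneg[of a] by (auto simp: divide_le_eq)
  have "15 / 16 * (Q * \<theta> a * N) = 15 / 16 * (Q ^ (l * a) * ?s)"
    by (simp only: hilton_milner_product(3))
  also have "\<dots> = Q ^ (l * a) * (?s * (15 / 16))"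
    by (simp only: mult_ac)
  also have "\<dots> \<le> Q ^ (l * a) * (?s * (1 - ?s))"
    using s Q_ge_2 by (intro mult_left_mono) auto
  also have "\<dots> = Q ^ (l * a) - Q ^ (l * a) * (1 - ?s + ?s\<^sup>2)"
    by (simp add: power2_eq_square algebra_simps)
  also have "\<dots> \<le> Q ^ (l * a) - (\<Prod>j = 1..a. Q ^ l - Q ^ j)"
    using hilton_milner_product(2) by simp
  also have "\<dots> \<le> hilton_milner_size"
    using Q_ge_2 by simp
  finally show ?thesis .
qed

lemma hilton_milner_size_le: "hilton_milner_size \<le> Q * \<theta> a * N + Q ^ n"
proof -
  have "Q ^ (l * a) - (\<Prod>j = 1..a. Q ^ l - Q ^ j) \<le> Q * \<theta> a * N"
    using hilton_milner_product(1,3) by (simp add: right_diff_distrib)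
  moreover have "Q ^ a * Q ^ t = Q ^ n"
    using t_le by (simp flip: power_add)
  moreover have "0 \<le> Q ^ a" by simp
  ultimately show ?thesis
    unfolding right_diff_distrib mult_1_right by linarith
qed

lemma shadow_size_eq: "shadow_size = N + Q * \<theta> (t + 1) * (N - N2)"
  using theta_Suc[of "t + 1"] by (simp add: algebra_simps)

lemma N2_le: "16 * N2 \<le> N"
proof -
  have "1 \<le> Q * \<theta> a"
    using Q_ge_2 theta_ge_1[of a] t_le mult_mono[of 1 Q 1 "\<theta> a"] by simp
  then have "16 \<le> Q ^ l" using q_theta_le_power_l by linarith
  then show ?thesis
    unfolding N_eq by (rule mult_right_mono) (use N2_ge_1 in linarith)
qed

text \<open>In this range \<open>\<theta> a \<le> \<theta> (t + 1)\<close>, and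
  \<open>N - N2\<close> is at least \<open>15 / 16 * N\<close>.\<close>

lemma shadow_size_ge:
  assumes "a \<le> t + 1"
  shows "15 / 16 * (Q * \<theta> a * N) \<le> shadow_size"
proof -
  have "15 / 16 * (Q * \<theta> a * N) = Q * \<theta> a * (15 / 16 * N)" by simp
  also have "\<dots> \<le> Q * \<theta> (t + 1) * (N - N2)"
    using theta_mono[OF assms] N2_le N2_ge_1 theta_nonneg Q_ge_2 by (intro mult_mono) auto
  also have "\<dots> \<le> shadow_size"
    unfolding shadow_size_eq using Q_ge_2 by simp
  finally show ?thesis .
qed

lemma theta_N_less: "\<theta> a * N < 15 / 16 * (Q * \<theta> a * N)"
proof -
  have "0 < \<theta> a * N" using theta_pos[of a] t_le Q_ge_2 by simp
  then have "1 * (\<theta> a * N) < (15 / 16 * Q) * (\<theta> a * N)"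
    using Q_ge_2 by (intro mult_strict_right_mono) auto
  then show ?thesis by simp
qed

text \<open>Both smaller quantities are at most \<open>N * \<theta> (t + 2)\<close>, hence at most
  \<open>\<theta> a * N\<close>, whereas the Hilton-Milner size has a further factor of at least
  \<open>15 / 16 * Q\<close>.\<close>

lemma shadow_size_less_hilton_milner_size:
  assumes "t + 2 \<le> a"
  shows "shadow_size < hilton_milner_size" "Q ^ (t + 1) * N < hilton_milner_size"
proof -
  have "shadow_size \<le> N * \<theta> (t + 2)"
    using theta_nonneg Q_ge_2 by simp
  moreover have t2: "N * \<theta> (t + 2) \<le> \<theta> a * N"
    using theta_mono[OF assms] by (subst mult.commute) (intro mult_right_mono, simp_all)
  moreover have "Q ^ (t + 1) * N \<le> N * \<theta> (t + 2)"
    using power_le_theta_Suc[of "t + 1"] by (subst mult.commute) (intro mult_left_mono, simp_all)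
  ultimately show "shadow_size < hilton_milner_size" "Q ^ (t + 1) * N < hilton_milner_size"
    using theta_N_less hilton_milner_size_ge by linarith+
qed

text \<open>At the boundary \<open>a = t + 1\<close> the terms \<open>Q * \<theta> a * N\<close> and
  \<open>Q * \<theta> (t + 1) * N\<close> agree. The separate summand \<open>N\<close> in
  \<open>shadow_size_eq\<close> decides, as it exceeds \<open>Q ^ n\<close> and
  \<open>Q * \<theta> (t + 1) * N2\<close> together.\<close>

lemma hilton_milner_size_less_shadow_size:
  assumes "a \<le> t + 1"
  shows "hilton_milner_size < shadow_size" "Q ^ (t + 1) * N < shadow_size"
proof -
  have "Q * \<theta> a * N \<le> Q * \<theta> (t + 1) * N"
    using theta_mono[OF assms] Q_ge_2 by (intro mult_right_mono mult_left_mono) auto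
  moreover have "Q ^ n + Q * \<theta> (t + 1) * N2 < N"
  proof -
    have "Q * \<theta> (t + 1) \<le> Q * Q ^ (t + 1)"
      by (intro mult_left_mono theta_le) simp
    also have "\<dots> = Q ^ (t + 2)" by simp
    also have "\<dots> \<le> Q ^ n" using Q_ge_2 t_le by (intro power_increasing) auto
    finally have 1: "Q * \<theta> (t + 1) \<le> Q ^ n" .
    have "Q ^ n + Q * \<theta> (t + 1) * N2 \<le> Q ^ n * N2 + Q ^ n * N2"
    proof (rule add_mono)
      have "Q ^ n * 1 \<le> Q ^ n * N2"
        by (rule mult_left_mono[OF N2_ge_1]) simp
      then show "Q ^ n \<le> Q ^ n * N2" by simp
      show "Q * \<theta> (t + 1) * N2 \<le> Q ^ n * N2"
        by (rule mult_right_mono[OF 1]) (use N2_ge_1 in linarith)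
    qed
    also have "\<dots> = (2 * Q ^ n) * N2" by simp
    also have "\<dots> \<le> Q ^ (n + 1) * N2"
      by (rule mult_right_mono) (use Q_ge_2 in simp_all)
    also have "\<dots> < Q ^ l * N2"
    proof (rule mult_strict_right_mono)
      show "Q ^ (n + 1) < Q ^ l"
        by (rule power_strict_increasing) (use Q_ge_2 l_ge in auto)
    qed (use N2_ge_1 in linarith)
    finally show ?thesis by (simp only: N_eq)
  qed
  ultimately show "hilton_milner_size < shadow_size"
    using hilton_milner_size_le unfolding shadow_size_eq by (simp add: right_diff_distrib)
  have "\<theta> (t + 2) = \<theta> (t + 1) + Q ^ (t + 1)" using theta_Suc'[of "t + 1"] by simp
  then have eq: "shadow_size - Q ^ (t + 1) * N = \<theta> (t + 1) * (N - Q * N2)"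
    by (simp add: algebra_simps)
  have "Q * N2 < Q ^ l * N2"
  proof (rule mult_strict_right_mono)
    show "Q < Q ^ l"
      using power_strict_increasing[of 1 l Q] Q_ge_2 l_ge by simp
  qed (use N2_ge_1 in linarith)
  then have "0 < \<theta> (t + 1) * (N - Q * N2)"
    unfolding N_eq using theta_pos[of "t + 1"] by simp
  then show "Q ^ (t + 1) * N < shadow_size" using eq by linarith
qed

end

end

section \<open>Extremal families\<close>

context attenuated_space
begin

text \<open>A maximal enlargement stays non-trivial because its intersection only shrinks;
  containments and upper bounds found for it pass down to \<open>\<F>\<close>. The outcomes
  \<open>few_covers\<close> and \<open>large_covers\<close> merge into \<open>small\<close>.\<close>

lemma intersecting_family_cases:
  assumes params: "1 \<le> t" "t + 2 \<le> n" "n + t + 2 \<le> l" "q = 2 \<longrightarrow> n + t + 4 \<le> l"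
    and family: "\<F> \<subseteq> complements" "\<forall>A\<in>\<F>. \<forall>B\<in>\<F>. t \<le> dim (A \<inter> B)" "dim (\<Inter>\<F>) < t"
  obtains
    (shadow) Z where "subspace Z" "dim Z = t + 2" "Z \<inter> W = {0}"
      "\<F> \<subseteq> {F \<in> complements. t + 1 \<le> dim (F \<inter> Z)}"
  | (shadow_meeting_W) "real (card \<F>) \<le> real q ^ (t + 1) * real q ^ (l * (n - t - 1))"
  | (hilton_milner) X M where "subspace X" "dim X = t" "X \<inter> W = {0}"
      "subspace M" "dim M = n + 1" "dim (M \<inter> W) = 1" "X \<subseteq> M"
      "\<F> \<subseteq> {F \<in> complements. X \<subseteq> F \<and> t + 1 \<le> dim (F \<inter> M)} \<union> {F \<in> complements. F \<subseteq> M}"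
  | (small) "real (card \<F>) < 15 / 16 * (real q * \<theta> (n - t) * real q ^ (l * (n - t - 1)))"
proof -
  obtain \<G> where \<G>: "\<F> \<subseteq> \<G>" "\<G> \<subseteq> complements" "\<And>A B. A \<in> \<G> \<Longrightarrow> B \<in> \<G> \<Longrightarrow> t \<le> dim (A \<inter> B)"
    and max: "\<And>A. A \<in> complements \<Longrightarrow> (\<And>B. B \<in> \<G> \<Longrightarrow> t \<le> dim (A \<inter> B)) \<Longrightarrow> A \<in> \<G>"
    using exists_maximal_intersecting_family[of \<F> t] family params(2) by auto
  have "dim (\<Inter>\<G>) < t"
    using dim_subset[OF Inter_anti_mono[OF \<G>(1)]] family(3) by simp
  then interpret g: nontrivial_intersecting_family scale Basis q W n l t \<G>
    using \<G> params by unfold_locales auto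
  have card: "real (card \<F>) \<le> real (card \<G>)"
    using card_mono[OF _ \<G>(1)] by simp
  have "\<forall>A\<in>complements. (\<forall>B\<in>\<G>. t \<le> dim (A \<inter> B)) \<longrightarrow> A \<in> \<G>"
    using max by simp
  then show ?thesis
  proof (cases rule: g.maximal_family_structure)
    case (shadow Z)
    show ?thesis
      by (rule that(1)[OF shadow(1-3)]) (rule order_trans[OF \<G>(1) shadow(4)])
  next
    case shadow_meeting_W
    show ?thesis
      by (rule that(2)) (use shadow_meeting_W card in linarith)
  next
    case (hilton_milner X M)
    show ?thesis
      by (rule that(3)[OF hilton_milner(1-7)]) (rule order_trans[OF \<G>(1) hilton_milner(8)])
  next
    case few_covers
    show ?thesis
      by (rule that(4)) (use few_covers few_covers_bound[OF params] card in linarith)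
  next
    case (large_covers i)
    show ?thesis
      by (rule that(4)) (use large_covers large_covers_bound[OF params large_covers(1,2)] card in linarith)
  qed
qed

section \<open>Extremal configurations in terms of subspace types\<close>

lemma has_type_0_iff: "has_type scale W m 0 P \<longleftrightarrow> subspace P \<and> dim P = m \<and> P \<inter> W = {0}"
proof -
  have "dim (P \<inter> W) = 0 \<longleftrightarrow> P \<inter> W = {0}" if "subspace P"
    using that subspace_W by (intro dim_trivial_subspace subspace_inter)
  then show ?thesis
    unfolding has_type_def by blast
qed

lemma subspaces_of_type_0: "subspaces_of_type scale W S n 0 = {F \<in> complements. F \<subseteq> S}"
  by (auto simp: subspaces_of_type_def has_type_0_iff complements_def)

lemma H1_eq: "H1 scale W n t X M
    = {F \<in> complements. X \<subseteq> F \<and> t + 1 \<le> dim (F \<inter> M)} \<union> {F \<in> complements. F \<subseteq> M}"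
  by (simp add: H1_def subspaces_of_type_0)

lemma card_H1:
  assumes "has_type scale W t 0 X" "has_type scale W (n + 1) 1 M" "X \<subseteq> M" "t < n"
  shows "real (card (H1 scale W n t X M))
    = real q ^ (l * (n - t)) - (\<Prod>j = 1..n - t. real q ^ l - real q ^ j)
      + real q ^ (n - t) * (real q ^ t - 1)"
  unfolding H1_eq
  using assms by (intro card_hilton_milner) (simp_all add: has_type_0_iff, simp_all add: has_type_def)

lemma card_subspaces_meeting:
  assumes "has_type scale W (t + 2) 0 Z"
  shows "real (card {F \<in> subspaces_of_type scale W UNIV n 0. t + 1 \<le> dim (F \<inter> Z)})
    = real q ^ (l * (n - t - 1)) * \<theta> (t + 2) - real q ^ (l * (n - t - 2) + 1) * \<theta> (t + 1)"
  using card_shadow[of Z t] assms by (simp add: has_type_0_iff subspaces_of_type_0)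

end

theorem theorem1p2:
  fixes scale :: "'a::{field,finite} \<Rightarrow> 'b::ab_group_add \<Rightarrow> 'b"
    and W :: "'b set" and \<F> :: "'b set set" and n l t q :: nat
  assumes "vector_space scale"
    and "q = CARD('a)"
    and "vector_space.dim scale (UNIV :: 'b set) = n + l"
    and "module.subspace scale W" and "vector_space.dim scale W = l"
    and "1 \<le> t" and "t + 2 \<le> n" and "n + t + 2 \<le> l"
    and "(l, q) \<noteq> (n + t + 2, 2)" and "(l, q) \<noteq> (n + t + 3, 2)"
    and "\<F> \<subseteq> subspaces_of_type scale W UNIV n 0"
    and "t_intersecting scale t \<F>"
    and "nontrivial scale t \<F>"
  shows "(real t \<le> real n / 2 - 1 \<longrightarrow>
           real (card \<F>) \<le> real q ^ (l * (n - t)) - (\<Prod>j = 1..n - t. real q ^ l - real q ^ j)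
                             + real q ^ (n - t) * (real q ^ t - 1) \<and>
           (real (card \<F>) = real q ^ (l * (n - t)) - (\<Prod>j = 1..n - t. real q ^ l - real q ^ j)
                             + real q ^ (n - t) * (real q ^ t - 1) \<longleftrightarrow>
            (\<exists>X M. has_type scale W t 0 X \<and>
                   has_type scale W (n + 1) 1 M \<and> X \<subseteq> M \<and>
                   \<F> = H1 scale W n t X M)))
       \<and> (real n / 2 - 1 / 2 \<le> real t \<longrightarrow>
           real (card \<F>) \<le> real q ^ (l * (n - t - 1)) * theta q (t + 2)
                             - real q ^ (l * (n - t - 2) + 1) * theta q (t + 1) \<and>
           (real (card \<F>) = real q ^ (l * (n - t - 1)) * theta q (t + 2)
                             - real q ^ (l * (n - t - 2) + 1) * theta q (t + 1) \<longleftrightarrow>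
            (\<exists>Z. has_type scale W (t + 2) 0 Z \<and>
                 \<F> = {F \<in> subspaces_of_type scale W UNIV n 0.
                        t + 1 \<le> vector_space.dim scale (F \<inter> Z)})))"
proof -
  interpret vector_space scale by fact
  obtain B where "B \<subseteq> UNIV" and B: "independent B" "UNIV \<subseteq> span B" "card B = dim UNIV"
    by (rule basis_exists)
  \<comment> \<open>The cardinality \<open>n + l\<close> is positive, and infinite sets have
    cardinality 0.\<close>
  have "finite B"
    using B(3) assms(3,7) card_ge_0_finite[of B] by simp
  then interpret attenuated_space scale B q W n l
    by (unfold_locales) (use B assms(2-5) in auto)
  have params: "1 \<le> t" "t + 2 \<le> n" "n + t + 2 \<le> l" "q = 2 \<longrightarrow> n + t + 4 \<le> l"
    using assms(6-10) by auto
  have family: "\<F> \<subseteq> complements" "\<forall>A\<in>\<F>. \<forall>B\<in>\<F>. t \<le> dim (A \<inter> B)"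
      "dim (\<Inter>\<F>) < t"
    using assms(11-13) by (simp_all add: subspaces_of_type_0 t_intersecting_def nontrivial_def)
  let ?A = "real q ^ (l * (n - t)) - (\<Prod>j = 1..n - t. real q ^ l - real q ^ j)
      + real q ^ (n - t) * (real q ^ t - 1)"
  let ?B = "real q ^ (l * (n - t - 1)) * theta q (t + 2)
      - real q ^ (l * (n - t - 2) + 1) * theta q (t + 1)"
  let ?H = "\<lambda>X M. has_type scale W t 0 X \<and> has_type scale W (n + 1) 1 M \<and> X \<subseteq> M"
  let ?S = "\<lambda>Z. {F \<in> subspaces_of_type scale W UNIV n 0. t + 1 \<le> dim (F \<inter> Z)}"
  have card_H: "real (card (H1 scale W n t X M)) = ?A" if "?H X M" for X M
    using card_H1[of t X M] that params(2) by simp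
  have card_S: "real (card (?S Z)) = ?B" if "has_type scale W (t + 2) 0 Z" for Z
    using card_subspaces_meeting[OF that] .
  have cases: "(\<exists>Z. has_type scale W (t + 2) 0 Z \<and> \<F> \<subseteq> ?S Z)
      \<or> (\<exists>X M. ?H X M \<and> \<F> \<subseteq> H1 scale W n t X M)
      \<or> real (card \<F>) \<le> real q ^ (t + 1) * real q ^ (l * (n - t - 1))
      \<or> real (card \<F>) < 15 / 16 * (real q * \<theta> (n - t) * real q ^ (l * (n - t - 1)))"
  proof (cases rule: intersecting_family_cases[OF params family])
    case (1 Z)
    then have "has_type scale W (t + 2) 0 Z \<and> \<F> \<subseteq> ?S Z"
      by (simp add: has_type_0_iff subspaces_of_type_0)
    then show ?thesis by (intro disjI1 exI)
  next
    case (3 X M)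
    then have "?H X M \<and> \<F> \<subseteq> H1 scale W n t X M"
      unfolding H1_eq by (simp add: has_type_0_iff) (simp add: has_type_def)
    then show ?thesis by (intro disjI2[OF disjI1] exI)
  qed auto
  \<comment> \<open>Containment in a finite candidate family yields both the bound and, at equal
    size, equality of the families.\<close>
  have extremal: "card \<F> \<le> card \<E> \<and> (card \<F> = card \<E> \<longrightarrow> \<F> = \<E>)" if "\<F> \<subseteq> \<E>" for \<E>
    using card_mono[OF _ that] card_subset_eq[OF _ that] by simp
  show ?thesis
  proof (intro conjI impI)
    assume "real t \<le> real n / 2 - 1"
    \<comment> \<open>In integers the two ranges of \<open>t\<close> read
      \<open>t + 2 \<le> n - t\<close> and \<open>n - t \<le> t + 1\<close>, so they are
      complementary.\<close>
    then have "t + 2 \<le> n - t" by linarith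
    note less = shadow_size_less_hilton_milner_size[OF params this] hilton_milner_size_ge[OF params]
    have "real (card \<F>) < ?A \<or> (\<exists>X M. ?H X M \<and> \<F> \<subseteq> H1 scale W n t X M)"
      using cases
    proof (elim disjE exE conjE)
      fix Z assume Z: "has_type scale W (t + 2) 0 Z" "\<F> \<subseteq> ?S Z"
      then show ?thesis
        using extremal[OF Z(2)] card_S[OF Z(1)] less(1) by linarith
    next
      fix X M assume "has_type scale W t 0 X" "has_type scale W (n + 1) 1 M" "X \<subseteq> M"
        "\<F> \<subseteq> H1 scale W n t X M"
      then show ?thesis by blast
    qed (use less(2,3) in linarith)+
    then have *: "real (card \<F>) < ?A \<or> real (card \<F>) = ?A \<and> (\<exists>X M. ?H X M \<and> \<F> = H1 scale W n t X M)"
    proof (elim disjE exE conjE)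
      fix X M assume H: "has_type scale W t 0 X" "has_type scale W (n + 1) 1 M" "X \<subseteq> M"
        "\<F> \<subseteq> H1 scale W n t X M"
      have "real (card (H1 scale W n t X M)) = ?A" using card_H H by blast
      then have "real (card \<F>) < ?A \<or> real (card \<F>) = ?A \<and> \<F> = H1 scale W n t X M"
        using extremal[OF H(4)] by linarith
      then show ?thesis using H by blast
    qed simp
    then show "real (card \<F>) \<le> ?A" by linarith
    show "real (card \<F>) = ?A \<longleftrightarrow> (\<exists>X M. has_type scale W t 0 X \<and> has_type scale W (n + 1) 1 M
        \<and> X \<subseteq> M \<and> \<F> = H1 scale W n t X M)"
      using * card_H by auto
  next
    assume "real n / 2 - 1 / 2 \<le> real t"
    then have "n - t \<le> t + 1" by linarith
    note less = hilton_milner_size_less_shadow_size[OF params this]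
      shadow_size_ge[OF params \<open>n - t \<le> t + 1\<close>]
    have "real (card \<F>) < ?B \<or> (\<exists>Z. has_type scale W (t + 2) 0 Z \<and> \<F> \<subseteq> ?S Z)"
      using cases
    proof (elim disjE exE conjE)
      fix X M assume H: "has_type scale W t 0 X" "has_type scale W (n + 1) 1 M" "X \<subseteq> M"
        "\<F> \<subseteq> H1 scale W n t X M"
      have "real (card (H1 scale W n t X M)) = ?A" using card_H H by blast
      then show ?thesis
        using extremal[OF H(4)] less(1) by linarith
    next
      fix Z assume "has_type scale W (t + 2) 0 Z" "\<F> \<subseteq> ?S Z"
      then show ?thesis by blast
    qed (use less(2,3) in linarith)+
    then have *: "real (card \<F>) < ?B
        \<or> real (card \<F>) = ?B \<and> (\<exists>Z. has_type scale W (t + 2) 0 Z \<and> \<F> = ?S Z)"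
    proof (elim disjE exE conjE)
      fix Z assume Z: "has_type scale W (t + 2) 0 Z" "\<F> \<subseteq> ?S Z"
      have "real (card \<F>) < ?B \<or> real (card \<F>) = ?B \<and> \<F> = ?S Z"
        using extremal[OF Z(2)] card_S[OF Z(1)] by linarith
      then show ?thesis using Z by blast
    qed simp
    then show "real (card \<F>) \<le> ?B" by linarith
    show "real (card \<F>) = ?B \<longleftrightarrow> (\<exists>Z. has_type scale W (t + 2) 0 Z \<and> \<F> = ?S Z)"
      using * card_S by auto
  qed
qed

end
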